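(* Let $f$ be the two-layer network below with scaling factor $b=\sqrt m$, let $\delta\in(0,1)$, $D>1$, and $R=D\sqrt d$. Let $x_1,\dots,x_T\in\mathbb{S}_p$ and let $\ell_1,\dots,\ell_T:\mathbb{R}^d\to\mathbb{R}$ be convex, differentiable and $L$-Lipschitz. Then with probability at least $1-\delta$ over the random initialization, Algorithm 1 with step sizes $\eta_t=\frac{2R}{CL}t^{-1/2}$ satisfies $$\sum_{t=1}^T\ell_t(f(\theta_t;x_t))\le\min_{g\in\mathcal F^d_{RF}(D)}\sum_{t=1}^T\ell_t(g(x_t))+\tilde O\Big(\frac{L\sqrt{dp}\,CD^2T}{\sqrt m}\Big)+O\Big(CLD\sqrt{dT}+\frac{CLD^2dT}{\sqrt m}\Big),$$ where $\tilde O$ hides factors polylogarithmic in $\delta$ and $d$.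
   Context: Let $p,d\ge1$, $m$ an even positive integer, $b>0$, $C>0$, and $\mathbb{S}_p=\{x\in\mathbb{R}^p:\|x\|_2=1\}$. Let $\sigma:\mathbb{R}\to\mathbb{R}$ be differentiable with $|\sigma'(z)-\sigma'(z')|\le C|z-z'|$ and $|\sigma'(z)|\le C$ for all $z,z'$. Parameters are $\theta=(\theta[1],\dots,\theta[d])\in\mathbb{R}^{d\times m\times p}$, where $\theta[i]\in\mathbb{R}^{m\times p}$ has rows $\theta[i,1]^\top,\dots,\theta[i,m/2]^\top,\bar\theta[i,1]^\top,\dots,\bar\theta[i,m/2]^\top$. The two-layer network is $f(\theta;x)=(f_1(\theta[1];x),\dots,f_d(\theta[d];x))^\top$ with $f_i(\theta[i];x)=\frac1b\big(\sum_{r=1}^{m/2}a_{i,r}\sigma(\theta[i,r]^\top x)+\sum_{r=1}^{m/2}\bar a_{i,r}\sigma(\bar\theta[i,r]^\top x)\big)$, where the $a_{i,r}$ are independent uniform signs in $\{\pm1\}$ and $\bar a_{i,r}=-a_{i,r}$, fixed. The random initialization $\theta_1$ has $\theta_1[i,r]\sim\mathcal N(0,I_p)$ i.i.d. for $r\le m/2$ and $\bar\theta_1[i,r]=\theta_1[i,r]$. $B(R)=\{\theta:\|\theta-\theta_1\|_F\le R\}$. Algorithm 1 (OGD for neural networks): start at $\theta_1$; at round $t$ play $\theta_t$, receive $x_t,\ell_t$, update $\theta_{t+1}=\Pi_{B(R)}(\theta_t-\eta_t\nabla_\theta\ell_t(f(\theta_t;x_t)))$ with $\Pi_{B(R)}$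 the Frobenius projection. Random feature space: for $c:\mathbb{R}^p\to\mathbb{R}^p$, consider $h(x)=\int_{\mathbb{R}^p}c(w)^\top x\,\sigma'(w^\top x)\,dw$ with RF-norm $\|h\|_{RF}=\sup_w\|c(w)\|_2/p_0(w)$, where $p_0$ is the density of $\mathcal N(0,I_p)$; $\mathcal F_{RF}(D)$ is the set of such $h$ with $\|h\|_{RF}\le D$, and $\mathcal F^d_{RF}(D)=\{h=(h_1,\dots,h_d):h_i\in\mathcal F_{RF}(D)\}$. *)

theory Defs
  imports "HOL-Probability.Probability"
begin

text \<open>A vector of R^n is represented by a function nat => real; only the
coordinates k < n are relevant.  The subspace of such vectors whose other
coordinates vanish is vspace n.\<close>

definition vspace :: "nat \<Rightarrow> (nat \<Rightarrow> real) set" where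
  "vspace n = {y. \<forall>k\<ge>n. y k = 0}"

definition ip :: "nat \<Rightarrow> (nat \<Rightarrow> real) \<Rightarrow> (nat \<Rightarrow> real) \<Rightarrow> real" where
  "ip n y z = (\<Sum>k<n. y k * z k)"

definition vnorm :: "nat \<Rightarrow> (nat \<Rightarrow> real) \<Rightarrow> real" where
  "vnorm n y = sqrt (\<Sum>k<n. (y k)\<^sup>2)"

definition convex_vec :: "nat \<Rightarrow> ((nat \<Rightarrow> real) \<Rightarrow> real) \<Rightarrow> bool" where
  "convex_vec n F \<longleftrightarrow> (\<forall>y\<in>vspace n. \<forall>z\<in>vspace n. \<forall>u::real. 0 \<le> u \<and> u \<le> 1 \<longrightarrow>
      F (\<lambda>k. u * y k + (1 - u) * z k) \<le> u * F y + (1 - u) * F z)"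

definition lipschitz_vec :: "nat \<Rightarrow> real \<Rightarrow> ((nat \<Rightarrow> real) \<Rightarrow> real) \<Rightarrow> bool" where
  "lipschitz_vec n L F \<longleftrightarrow> (\<forall>y\<in>vspace n. \<forall>z\<in>vspace n.
      \<bar>F y - F z\<bar> \<le> L * vnorm n (\<lambda>k. y k - z k))"

definition has_grad_vec :: "nat \<Rightarrow> ((nat \<Rightarrow> real) \<Rightarrow> real) \<Rightarrow> (nat \<Rightarrow> real) \<Rightarrow> (nat \<Rightarrow> real) \<Rightarrow> bool" where
  "has_grad_vec n F y g \<longleftrightarrow> g \<in> vspace n \<and>
     (\<forall>e>0. \<exists>r>0. \<forall>h\<in>vspace n. 0 < vnorm n h \<and> vnorm n h < r \<longrightarrow>
        \<bar>F (\<lambda>k. y k + h k) - F y - ip n g h\<bar> \<le> e * vnorm n h)"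

definition differentiable_vec :: "nat \<Rightarrow> ((nat \<Rightarrow> real) \<Rightarrow> real) \<Rightarrow> bool" where
  "differentiable_vec n F \<longleftrightarrow> (\<forall>y\<in>vspace n. \<exists>g. has_grad_vec n F y g)"

definition grad_vec :: "nat \<Rightarrow> ((nat \<Rightarrow> real) \<Rightarrow> real) \<Rightarrow> (nat \<Rightarrow> real) \<Rightarrow> (nat \<Rightarrow> real)" where
  "grad_vec n F y = (SOME g. has_grad_vec n F y g)"

definition p0 :: "nat \<Rightarrow> (nat \<Rightarrow> real) \<Rightarrow> real" where
  "p0 p w = (2 * pi) powr (- real p / 2) * exp (- (\<Sum>k<p. (w k)\<^sup>2) / 2)"

definition lebesgue_Rp :: "nat \<Rightarrow> (nat \<Rightarrow> real) measure" where
  "lebesgue_Rp p = PiM {..<p} (\<lambda>_. lborel)"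

definition RF_space :: "(real \<Rightarrow> real) \<Rightarrow> nat \<Rightarrow> real \<Rightarrow> ((nat \<Rightarrow> real) \<Rightarrow> real) set" where
  "RF_space \<sigma> p D = {h. \<exists>c :: (nat \<Rightarrow> real) \<Rightarrow> (nat \<Rightarrow> real).
      (\<forall>k<p. (\<lambda>w. c w k) \<in> borel_measurable (lebesgue_Rp p)) \<and>
      (\<forall>w. vnorm p (c w) / p0 p w \<le> D) \<and>
      (\<forall>x. h x = (LINT w | lebesgue_Rp p. ip p (c w) x * deriv \<sigma> (ip p w x)))}"

definition RF_space_vec :: "(real \<Rightarrow> real) \<Rightarrow> nat \<Rightarrow> nat \<Rightarrow> real \<Rightarrow> ((nat \<Rightarrow> real) \<Rightarrow> (nat \<Rightarrow> real)) set" where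
  "RF_space_vec \<sigma> p d D = {g. (\<forall>i<d. (\<lambda>x. g x i) \<in> RF_space \<sigma> p D) \<and> (\<forall>x i. d \<le> i \<longrightarrow> g x i = 0)}"

text \<open>Parameters: theta i r is the r-th row (r < m) of theta[i] (i < d), a vector in R^p;
rows r < m/2 are theta[i,r], rows m/2 + r are bar-theta[i,r].  The output-layer signs are
a i r.\<close>

type_synonym params = "nat \<Rightarrow> nat \<Rightarrow> (nat \<Rightarrow> real)"

definition net :: "(real \<Rightarrow> real) \<Rightarrow> nat \<Rightarrow> nat \<Rightarrow> nat \<Rightarrow> real \<Rightarrow> (nat \<Rightarrow> nat \<Rightarrow> real)
                   \<Rightarrow> params \<Rightarrow> (nat \<Rightarrow> real) \<Rightarrow> (nat \<Rightarrow> real)" where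
  "net \<sigma> p d m b a \<theta> x = (\<lambda>i. if i < d then (1 / b) * (\<Sum>r<m. a i r * \<sigma> (ip p (\<theta> i r) x)) else 0)"

definition net_loss_grad :: "(real \<Rightarrow> real) \<Rightarrow> nat \<Rightarrow> nat \<Rightarrow> nat \<Rightarrow> real \<Rightarrow> (nat \<Rightarrow> nat \<Rightarrow> real)
     \<Rightarrow> ((nat \<Rightarrow> real) \<Rightarrow> real) \<Rightarrow> params \<Rightarrow> (nat \<Rightarrow> real) \<Rightarrow> params" where
  "net_loss_grad \<sigma> p d m b a F \<theta> x = (\<lambda>i r k.
     grad_vec d F (net \<sigma> p d m b a \<theta> x) i * (1 / b) * a i r * deriv \<sigma> (ip p (\<theta> i r) x) * x k)"

definition frob :: "nat \<Rightarrow> nat \<Rightarrow> nat \<Rightarrow> params \<Rightarrow> params \<Rightarrow> real" where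
  "frob p d m \<theta> \<theta>' = sqrt (\<Sum>i<d. \<Sum>r<m. (vnorm p (\<lambda>k. \<theta> i r k - \<theta>' i r k))\<^sup>2)"

definition proj_ball :: "nat \<Rightarrow> nat \<Rightarrow> nat \<Rightarrow> params \<Rightarrow> real \<Rightarrow> params \<Rightarrow> params" where
  "proj_ball p d m \<theta>1 R \<theta> =
     (if frob p d m \<theta> \<theta>1 \<le> R then \<theta>
      else (\<lambda>i r k. \<theta>1 i r k + (R / frob p d m \<theta> \<theta>1) * (\<theta> i r k - \<theta>1 i r k)))"

text \<open>ogd ... n is the iterate theta_(n+1) of Algorithm 1 (theta_1 is the initialization).\<close>
primrec ogd :: "(real \<Rightarrow> real) \<Rightarrow> nat \<Rightarrow> nat \<Rightarrow> nat \<Rightarrow> real \<Rightarrow> (nat \<Rightarrow> nat \<Rightarrow> real) \<Rightarrow> params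
     \<Rightarrow> real \<Rightarrow> (nat \<Rightarrow> real) \<Rightarrow> (nat \<Rightarrow> (nat \<Rightarrow> real) \<Rightarrow> real) \<Rightarrow> (nat \<Rightarrow> nat \<Rightarrow> real) \<Rightarrow> nat \<Rightarrow> params" where
  "ogd \<sigma> p d m b a \<theta>1 R \<eta> ell x 0 = \<theta>1"
| "ogd \<sigma> p d m b a \<theta>1 R \<eta> ell x (Suc n) =
     (let \<theta> = ogd \<sigma> p d m b a \<theta>1 R \<eta> ell x n;
          G = net_loss_grad \<sigma> p d m b a (ell (Suc n)) \<theta> (x (Suc n))
      in proj_ball p d m \<theta>1 R (\<lambda>i r k. \<theta> i r k - \<eta> (Suc n) * G i r k))"

text \<open>Sample omega = (S, G): S (i,r) independent uniform signs, G (i,r,k) independent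
standard Gaussians (i < d, r < m/2, k < p), so that theta_1[i,r] ~ N(0, I_p).\<close>

definition init_measure :: "nat \<Rightarrow> nat \<Rightarrow> nat \<Rightarrow> ((nat \<times> nat \<Rightarrow> real) \<times> (nat \<times> nat \<times> nat \<Rightarrow> real)) measure" where
  "init_measure p d m =
     PiM ({..<d} \<times> {..<m div 2}) (\<lambda>_. measure_pmf (pmf_of_set {-1, 1::real}))
     \<Otimes>\<^sub>M PiM ({..<d} \<times> {..<m div 2} \<times> {..<p}) (\<lambda>_. std_normal_distribution)"

definition init_signs :: "nat \<Rightarrow> (nat \<times> nat \<Rightarrow> real) \<Rightarrow> nat \<Rightarrow> nat \<Rightarrow> real" where
  "init_signs m S i r = (if r < m div 2 then S (i, r) else - S (i, r - m div 2))"

definition init_theta :: "nat \<Rightarrow> (nat \<times> nat \<times> nat \<Rightarrow> real) \<Rightarrow> params" where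
  "init_theta m G i r k = (if r < m div 2 then G (i, r, k) else G (i, r - m div 2, k))"

end

theory Submission
  imports Defs
begin

text \<open>Linearising the network in its parameters costs \<open>C R\<^sup>2 / sqrt m\<close> per round, so projected
gradient descent on the ball of radius \<open>R\<close> competes with every \<open>\<theta>\<close> in the ball up to that error and
the usual \<open>R C L sqrt T\<close>. For a target \<open>h\<^sub>i(x) = \<integral> c\<^sub>i(w) \<bullet> x \<sigma>'(w \<bullet> x) dw\<close> compare with the parameter
obtained by moving row \<open>w\<close> of output \<open>i\<close> by \<open>a c\<^sub>i(w) / (sqrt m p\<^sub>0(w))\<close>: it lies in the ball, and since the
paired signs cancel the initial network, its linearised output is the empirical mean over the
Gaussian rows of a bounded function with expectation \<open>h\<^sub>i\<close>.

The logarithmic factor must not depend on \<open>T\<close>, so there is no union bound over rounds. Instead the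
root mean square of the errors over all rounds and outputs is controlled at once, by Hoeffding's lemma
for each error and Jensen's inequality for \<open>u \<mapsto> exp (sqrt (1 + u))\<close>. The comparator depends on the
random rows, but the right-hand side of the bound is deterministic, so it suffices to treat one
near-minimiser \<open>g\<close> rather than all \<open>g\<close> uniformly.\<close>

section \<open>Vectors and gradients\<close>

text \<open>As a function of u = y^2, exp (sqrt u) is concave for u < 1, so Jensen's inequality
  fails for it; starting the square root at 1 puts its value exactly into the convex range and costs
  one factor e inside a logarithm. Averaging exponential moments over the errors, instead of taking
  a maximum, asks nothing of their joint law, which matters because all rounds share the same
  Gaussian rows; the price is ln (1 / \<delta>) in place of its square root. The infimum over g is
  finite because members of the class are bounded by C * D on the sphere, and fixing g before the
  draw keeps its coefficient functions deterministic, so that the sampled features are independent.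
  Quantifying over all g is an uncountable intersection, and \<open>measure\<close> is 0 off the
  sigma-algebra; written with the infimum, the event is one inequality for a measurable function,
  provided that the iterates are measurable. This is why a whole section is devoted to them.\<close>

lemma vnorm_eq_L2_set: "vnorm n y = L2_set y {..<n}"
  by (simp add: vnorm_def L2_set_def)

lemma vnorm_nonneg [simp]: "0 \<le> vnorm n y"
  by (simp add: vnorm_def sum_nonneg)

lemma power2_vnorm: "(vnorm n y)\<^sup>2 = (\<Sum>k<n. (y k)\<^sup>2)"
  by (simp add: vnorm_def sum_nonneg)

lemma abs_ip_le: "\<bar>ip n y z\<bar> \<le> vnorm n y * vnorm n z"
proof -
  have "\<bar>ip n y z\<bar> \<le> (\<Sum>k<n. \<bar>y k\<bar> * \<bar>z k\<bar>)"
    unfolding ip_def by (rule order_trans[OF sum_abs]) (simp add: abs_mult)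
  also have "\<dots> \<le> vnorm n y * vnorm n z"
    unfolding vnorm_eq_L2_set by (rule L2_set_mult_ineq)
  finally show ?thesis .
qed

lemma abs_component_le_vnorm: "k < n \<Longrightarrow> \<bar>y k\<bar> \<le> vnorm n y"
  using member_le_L2_set[of "{..<n}" k "\<lambda>i. \<bar>y i\<bar>"]
  by (simp add: vnorm_eq_L2_set L2_set_def)

lemma vnorm_triangle: "vnorm n (\<lambda>k. y k + z k) \<le> vnorm n y + vnorm n z"
  unfolding vnorm_eq_L2_set by (rule L2_set_triangle_ineq)

lemma vnorm_scale: "vnorm n (\<lambda>k. u * y k) = \<bar>u\<bar> * vnorm n y"
  by (simp add: vnorm_def power_mult_distrib real_sqrt_mult flip: sum_distrib_left)

lemma vnorm_le_sum: "vnorm n y \<le> (\<Sum>k<n. \<bar>y k\<bar>)"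
  unfolding vnorm_eq_L2_set by (rule L2_set_le_sum_abs)

lemma vnorm_le_of_components:
  assumes "\<And>k. k < n \<Longrightarrow> \<bar>y k\<bar> \<le> B" "0 \<le> B"
  shows "vnorm n y \<le> sqrt (real n) * B"
proof -
  have "(\<Sum>k<n. (y k)\<^sup>2) \<le> (\<Sum>k<n. B\<^sup>2)"
    using assms by (intro sum_mono) (metis abs_le_square_iff abs_of_nonneg lessThan_iff)
  then have "vnorm n y \<le> sqrt (real n * B\<^sup>2)"
    unfolding vnorm_def by simp
  then show ?thesis using assms(2) by (simp add: real_sqrt_mult)
qed

lemma ip_scale_right: "ip n v (\<lambda>k. u * h k) = u * ip n v h"
  by (simp add: ip_def sum_distrib_left mult_ac)

text \<open>Reduces the gradient in n variables to one-variable limits. Three uses follow: the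
  gradient inequality, the norm bound for gradients, and measurability of
  \<open>grad_vec\<close>.\<close>

lemma has_grad_vec_directional:
  assumes g: "has_grad_vec n F y g" and h: "h \<in> vspace n"
  shows "((\<lambda>u. (F (\<lambda>k. y k + u * h k) - F y) / u) \<longlongrightarrow> ip n g h) (at (0::real))"
proof (rule LIM_I)
  fix e :: real assume e: "0 < e"
  define N where "N = vnorm n h"
  have N0: "0 \<le> N" by (simp add: N_def)
  \<comment> \<open>N + 1 instead of N keeps the quotient meaningful when the direction has norm
    0.\<close>
  define e' where "e' = e / (2 * (N + 1))"
  have e': "0 < e'" using e N0 by (simp add: e'_def)
  have e'N: "e' * N < e"
  proof -
    have "e' * N \<le> e' * (N + 1)" using e' by simp
    also have "\<dots> = e / 2" using N0 by (simp add: e'_def field_simps)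
    finally show ?thesis using e by linarith
  qed
  obtain r where r: "0 < r" and R: "\<And>h. h \<in> vspace n \<Longrightarrow> 0 < vnorm n h \<Longrightarrow> vnorm n h < r \<Longrightarrow>
        \<bar>F (\<lambda>k. y k + h k) - F y - ip n g h\<bar> \<le> e' * vnorm n h"
    using g e' unfolding has_grad_vec_def by metis
  show "\<exists>s>0. \<forall>u. u \<noteq> 0 \<and> norm (u - 0) < s \<longrightarrow>
      norm ((F (\<lambda>k. y k + u * h k) - F y) / u - ip n g h) < e"
  proof (intro exI[of _ "r / (N + 1)"] conjI allI impI)
    show "0 < r / (N + 1)" using r N0 by simp
    fix u :: real assume u: "u \<noteq> 0 \<and> norm (u - 0) < r / (N + 1)"
    have uh: "(\<lambda>k. u * h k) \<in> vspace n" using h by (simp add: vspace_def)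
    show "norm ((F (\<lambda>k. y k + u * h k) - F y) / u - ip n g h) < e"
    \<comment> \<open>\<open>has_grad_vec\<close> says nothing about increments of norm 0, so a zero
      direction is treated apart; membership in \<open>vspace n\<close> makes it zero in every
      coordinate.\<close>
    proof (cases "N = 0")
      case True
      have h0: "h k = 0" for k
      proof (cases "k < n")
        case True
        then show ?thesis using abs_component_le_vnorm[of k n h] \<open>N = 0\<close> by (simp add: N_def)
      next
        case False then show ?thesis using h by (simp add: vspace_def)
      qed
      then show ?thesis using e by (simp add: ip_def)
    next
      case False
      then have N: "0 < N" using N0 by simp
      have "\<bar>u\<bar> * (N + 1) < r" using u N0 by (simp add: field_simps)
      moreover have "\<bar>u\<bar> * N \<le> \<bar>u\<bar> * (N + 1)" by (simp add: mult_left_mono)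
      ultimately have lt: "vnorm n (\<lambda>k. u * h k) < r" by (simp add: vnorm_scale N_def)
      have "0 < vnorm n (\<lambda>k. u * h k)" using N u by (simp add: vnorm_scale N_def)
      from R[OF uh this lt]
      have "\<bar>F (\<lambda>k. y k + u * h k) - F y - u * ip n g h\<bar> \<le> e' * N * \<bar>u\<bar>"
        by (simp add: vnorm_scale ip_scale_right N_def mult_ac)
      then have "\<bar>F (\<lambda>k. y k + u * h k) - F y - u * ip n g h\<bar> / \<bar>u\<bar> \<le> e' * N"
        using u by (simp add: divide_le_eq)
      also have "\<bar>F (\<lambda>k. y k + u * h k) - F y - u * ip n g h\<bar> / \<bar>u\<bar> =
          \<bar>(F (\<lambda>k. y k + u * h k) - F y) / u - ip n g h\<bar>"
        using u by (simp add: abs_divide[symmetric] diff_divide_distrib)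
      finally show ?thesis using e'N by simp
    qed
  qed
qed

lemma has_grad_vec_grad_vec:
  "differentiable_vec n F \<Longrightarrow> y \<in> vspace n \<Longrightarrow> has_grad_vec n F y (grad_vec n F y)"
  unfolding grad_vec_def differentiable_vec_def by (metis someI_ex)

text \<open>Along the segment from y to z, convexity keeps every difference quotient with 0 < u < 1
  below F z - F y. Letting u tend to 0 from the right turns the quotient into the inner product with
  g.\<close>

lemma convex_vec_grad_le:
  assumes cv: "convex_vec n F" and g: "has_grad_vec n F y g"
    and y: "y \<in> vspace n" and z: "z \<in> vspace n"
  shows "F y - F z \<le> ip n g (\<lambda>k. y k - z k)"
proof -
  let ?h = "\<lambda>k. z k - y k"
  have h: "?h \<in> vspace n" using y z by (simp add: vspace_def)
  have lim: "((\<lambda>u. (F (\<lambda>k. y k + u * ?h k) - F y) / u) \<longlongrightarrow> ip n g ?h) (at_right (0::real))"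
    using has_grad_vec_directional[OF g h] by (rule filterlim_mono) (auto intro: at_le)
  have "eventually (\<lambda>u::real. u \<in> {0<..<1}) (at_right 0)"
    by (rule eventually_at_right_real) simp
  then have ev: "eventually (\<lambda>u. (F (\<lambda>k. y k + u * ?h k) - F y) / u \<le> F z - F y) (at_right 0)"
  proof eventually_elim
    case (elim u)
    have "F (\<lambda>k. u * z k + (1 - u) * y k) \<le> u * F z + (1 - u) * F y"
      using cv y z elim unfolding convex_vec_def by simp
    also have "(\<lambda>k. u * z k + (1 - u) * y k) = (\<lambda>k. y k + u * ?h k)"
      by (simp add: algebra_simps)
    finally show ?case using elim by (simp add: field_simps)
  qed
  have "ip n g ?h \<le> F z - F y"
    by (rule tendsto_upperbound[OF lim ev]) simp
  moreover have "ip n g ?h = - ip n g (\<lambda>k. y k - z k)"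
    by (simp add: ip_def sum_negf[symmetric] algebra_simps)
  ultimately show ?thesis by simp
qed

text \<open>The directional derivative along g itself is the squared norm of g, while the Lipschitz
  condition bounds it by L times the norm.\<close>

lemma lipschitz_vec_grad_bound:
  assumes lip: "lipschitz_vec n L F" and g: "has_grad_vec n F y g"
    and y: "y \<in> vspace n" and L: "0 \<le> L"
  shows "vnorm n g \<le> L"
proof -
  have gv: "g \<in> vspace n" using g by (simp add: has_grad_vec_def)
  have "\<bar>(F (\<lambda>k. y k + u * g k) - F y) / u\<bar> \<le> L * vnorm n g" if "u \<noteq> 0" for u
  proof -
    have "(\<lambda>k. y k + u * g k) \<in> vspace n" using y gv by (simp add: vspace_def)
    then have "\<bar>F (\<lambda>k. y k + u * g k) - F y\<bar> \<le> L * vnorm n (\<lambda>k. (y k + u * g k) - y k)"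
      using lip y unfolding lipschitz_vec_def by blast
    then have "\<bar>F (\<lambda>k. y k + u * g k) - F y\<bar> \<le> L * vnorm n g * \<bar>u\<bar>"
      by (simp add: vnorm_scale mult_ac)
    then show ?thesis using that by (simp add: divide_le_eq)
  qed
  then have "(F (\<lambda>k. y k + u * g k) - F y) / u \<le> L * vnorm n g" if "u \<noteq> 0" for u
    using that abs_le_D1 by blast
  then have "eventually (\<lambda>u. (F (\<lambda>k. y k + u * g k) - F y) / u \<le> L * vnorm n g) (at (0::real))"
    unfolding eventually_at_filter by (intro always_eventually) blast
  then have "ip n g g \<le> L * vnorm n g"
    by (rule tendsto_upperbound[OF has_grad_vec_directional[OF g gv]]) simp
  then have "vnorm n g * vnorm n g \<le> L * vnorm n g"
    using power2_vnorm[of n g] by (simp add: ip_def power2_eq_square)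
  then show ?thesis using L vnorm_nonneg[of n g]
    by (cases "vnorm n g = 0") auto
qed

text \<open>The mean value theorem and one use of the Lipschitz condition give the factor C; the
  sharper C / 2 would only change constants.\<close>

lemma lipschitz_derivative_remainder:
  fixes s :: "real \<Rightarrow> real"
  assumes diff: "\<And>z. s differentiable (at z)"
    and lip: "\<And>z z'. \<bar>deriv s z - deriv s z'\<bar> \<le> C * \<bar>z - z'\<bar>"
  shows "\<bar>s z' - s z - deriv s z * (z' - z)\<bar> \<le> C * (z' - z)\<^sup>2"
proof -
  have D: "(s has_real_derivative deriv s w) (at w)" for w
    using diff[of w] by (simp add: DERIV_deriv_iff_real_differentiable)
  have C: "0 \<le> C" using lip[of 1 0] by simp
  obtain w where w: "\<bar>w - z\<bar> \<le> \<bar>z' - z\<bar>" "s z' - s z = deriv s w * (z' - z)"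
  proof (cases z z' rule: linorder_cases)
    case less
    from MVT2[OF this, of s "deriv s"] D obtain w where "z < w" "w < z'"
      "s z' - s z = (z' - z) * deriv s w" by blast
    then show ?thesis by (intro that[of w]) auto
  next
    case equal then show ?thesis by (intro that[of z]) auto
  next
    case greater
    from MVT2[OF this, of s "deriv s"] D obtain w where w: "z' < w" "w < z"
      "s z - s z' = (z - z') * deriv s w" by blast
    then have "s z' - s z = deriv s w * (z' - z)" by (simp add: algebra_simps)
    with w show ?thesis by (intro that[of w]) auto
  qed
  have "\<bar>s z' - s z - deriv s z * (z' - z)\<bar> = \<bar>deriv s w - deriv s z\<bar> * \<bar>z' - z\<bar>"
    unfolding w(2) by (simp add: abs_mult[symmetric] left_diff_distrib)
  also have "\<dots> \<le> (C * \<bar>z' - z\<bar>) * \<bar>z' - z\<bar>"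
    using lip[of w z] w(1) C by (intro mult_right_mono) (auto intro: order_trans mult_left_mono)
  finally show ?thesis by (simp add: power2_eq_square mult.assoc)
qed

section \<open>The parameter space and regret of projected gradient descent\<close>

text \<open>The Frobenius inner product. It is only positive semidefinite on \<open>params\<close>,
  since entries outside the index ranges are ignored.\<close>

definition pip :: "nat \<Rightarrow> nat \<Rightarrow> nat \<Rightarrow> params \<Rightarrow> params \<Rightarrow> real" where
  "pip p d m u v = (\<Sum>i<d. \<Sum>r<m. \<Sum>k<p. u i r k * v i r k)"

lemma frob_eq: "frob p d m u v = sqrt (pip p d m (u - v) (u - v))"
  by (simp add: frob_def pip_def power2_vnorm) (simp add: power2_eq_square)

lemma pip_self_nonneg: "0 \<le> pip p d m u u"
  by (simp add: pip_def sum_nonneg)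

lemma power2_frob: "(frob p d m u v)\<^sup>2 = pip p d m (u - v) (u - v)"
  by (simp add: frob_eq pip_self_nonneg)

lemma frob_nonneg [simp]: "0 \<le> frob p d m u v"
  by (simp add: frob_eq pip_self_nonneg)

lemma pip_commute: "pip p d m u v = pip p d m v u"
  by (simp add: pip_def mult.commute)

lemma pip_diff_left: "pip p d m (u - u') v = pip p d m u v - pip p d m u' v"
  by (simp add: pip_def sum_subtractf left_diff_distrib)

lemma pip_diff_right: "pip p d m u (v - v') = pip p d m u v - pip p d m u v'"
  by (simp add: pip_def sum_subtractf right_diff_distrib)

lemma pip_scale_left: "pip p d m (\<lambda>i r k. c * u i r k) v = c * pip p d m u v"
  by (simp add: pip_def sum_distrib_left mult.assoc)

lemma pip_scale_right: "pip p d m u (\<lambda>i r k. c * v i r k) = c * pip p d m u v"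
  by (simp add: pip_def sum_distrib_left mult_ac)

lemma power2_frob_minus:
  "pip p d m (u - v) (u - v) = pip p d m u u - 2 * pip p d m u v + pip p d m v v"
  by (simp add: pip_diff_left pip_diff_right pip_commute[of p d m v u])

text \<open>Cauchy-Schwarz, by flattening the triple sum. A common base point w appears because
  \<open>frob\<close> is available only as a distance.\<close>

lemma pip_le_frob:
  "pip p d m (u - w) (v - w) \<le> frob p d m u w * frob p d m v w"
proof -
  let ?J = "{..<d} \<times> {..<m} \<times> {..<p}"
  have eq: "pip p d m a b = (\<Sum>(i,r,k)\<in>?J. a i r k * b i r k)" for a b
    by (simp add: pip_def sum.cartesian_product)
  let ?a = "\<lambda>(i,r,k). (u - w) i r k" and ?b = "\<lambda>(i,r,k). (v - w) i r k"
  have "pip p d m (u - w) (v - w) \<le> (\<Sum>j\<in>?J. \<bar>?a j\<bar> * \<bar>?b j\<bar>)"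
    unfolding eq by (intro sum_mono) (auto simp: abs_mult[symmetric])
  also have "\<dots> \<le> L2_set ?a ?J * L2_set ?b ?J"
    by (rule L2_set_mult_ineq)
  also have "\<dots> = frob p d m u w * frob p d m v w"
    unfolding frob_eq eq L2_set_def
    by (auto intro!: arg_cong2[where f = "(*)"] arg_cong[where f = sqrt] sum.cong simp: power2_eq_square)
  finally show ?thesis .
qed

lemma frob_proj_ball_le:
  assumes "0 \<le> R"
  shows "frob p d m (proj_ball p d m c R u) c \<le> R"
proof (cases "frob p d m u c \<le> R")
  case False
  define N where "N = frob p d m u c"
  have N: "0 < N" using False assms by (simp add: N_def)
  have "proj_ball p d m c R u - c = (\<lambda>i r k. (R / N) * (u - c) i r k)"
    using False by (simp add: proj_ball_def N_def fun_eq_iff)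
  then have "(frob p d m (proj_ball p d m c R u) c)\<^sup>2 = (R / N)\<^sup>2 * N\<^sup>2"
    by (simp only: power2_frob pip_scale_left pip_scale_right N_def power2_eq_square[of "R / _"] mult.assoc)
  also have "\<dots> = R\<^sup>2" using N by (simp add: power_divide)
  finally show ?thesis using assms by (simp add: power2_eq_iff_nonneg)
qed (simp add: proj_ball_def)

text \<open>With N the distance from u to the centre c and q the inner product of u - c and v - c,
  the two squared distances differ by (N - R) * ((N + R) - 2 * q / N). Cauchy-Schwarz gives q \<le>
  N * R, which makes both factors nonnegative.\<close>

lemma frob_proj_ball_contract:
  assumes R: "0 \<le> R" and v: "frob p d m v c \<le> R"
  shows "(frob p d m (proj_ball p d m c R u) v)\<^sup>2 \<le> (frob p d m u v)\<^sup>2"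
proof (cases "frob p d m u c \<le> R")
  case False
  define N where "N = frob p d m u c"
  have N: "R < N" "0 < N" using False R by (auto simp: N_def)
  let ?a = "u - c" and ?z = "v - c"
  have eq: "proj_ball p d m c R u - v = (\<lambda>i r k. (R / N) * ?a i r k) - ?z" "u - v = ?a - ?z"
    using False by (simp_all add: proj_ball_def N_def fun_eq_iff)
  have aa: "pip p d m ?a ?a = N\<^sup>2" by (simp add: N_def power2_frob)
  define q where "q = pip p d m ?a ?z"
  have q: "q \<le> N * R"
  proof -
    have "q \<le> N * frob p d m v c" unfolding q_def N_def by (rule pip_le_frob)
    also have "\<dots> \<le> N * R" using v N by simp
    finally show ?thesis .
  qed
  have "(frob p d m u v)\<^sup>2 = N\<^sup>2 - 2 * q + pip p d m ?z ?z"
    unfolding power2_frob eq(2) power2_frob_minus[of p d m ?a ?z] aa q_def ..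
  moreover have "(frob p d m (proj_ball p d m c R u) v)\<^sup>2
      = (R / N) * ((R / N) * N\<^sup>2) - 2 * ((R / N) * q) + pip p d m ?z ?z"
    unfolding power2_frob eq(1) power2_frob_minus[of p d m _ ?z] pip_scale_left pip_scale_right aa q_def ..
  ultimately have "(frob p d m u v)\<^sup>2 - (frob p d m (proj_ball p d m c R u) v)\<^sup>2
      = N\<^sup>2 - 2 * q - ((R / N) * ((R / N) * N\<^sup>2) - 2 * ((R / N) * q))"
    by simp
  also have "\<dots> = (N - R) * ((N + R) - 2 * q / N)"
    using N by (simp add: field_simps power2_eq_square)
  also have "\<dots> \<ge> 0"
  proof -
    have "q / N \<le> R" using q N by (simp add: divide_le_eq mult.commute)
    then show ?thesis using N by (intro mult_nonneg_nonneg) auto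
  qed
  finally show ?thesis by simp
qed (simp add: proj_ball_def)

lemma frob_triangle_power2:
  assumes "frob p d m u c \<le> R" "frob p d m v c \<le> R"
  shows "(frob p d m u v)\<^sup>2 \<le> 4 * R\<^sup>2"
proof -
  have R: "0 \<le> R" using assms(1) frob_nonneg order_trans by blast
  let ?a = "u - c" and ?b = "v - c"
  have "u - v = ?a - ?b" by (simp add: fun_eq_iff)
  then have "(frob p d m u v)\<^sup>2 = (frob p d m u c)\<^sup>2 - 2 * pip p d m ?a ?b + (frob p d m v c)\<^sup>2"
    by (simp only: power2_frob power2_frob_minus)
  moreover have "- pip p d m ?a ?b \<le> R\<^sup>2"
  proof -
    \<comment> \<open>c - (u - c) is the reflection of u in c; its displacement from c is the
      negative of that of u, so Cauchy-Schwarz also bounds the inner product from below.\<close>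
    have neg: "- pip p d m ?a ?b = pip p d m ((c - ?a) - c) ?b"
      by (simp add: pip_def sum_negf sum_subtractf algebra_simps)
    have "pip p d m ((c - ?a) - c) ?b \<le> frob p d m (c - ?a) c * frob p d m v c"
      by (rule pip_le_frob)
    also have "frob p d m (c - ?a) c = frob p d m u c"
      by (simp add: frob_def vnorm_def power2_commute)
    also have "frob p d m u c * frob p d m v c \<le> R * R"
      using assms R by (intro mult_mono) auto
    finally show ?thesis unfolding neg power2_eq_square .
  qed
  moreover have "(frob p d m u c)\<^sup>2 \<le> R\<^sup>2" "(frob p d m v c)\<^sup>2 \<le> R\<^sup>2"
    using assms by (simp_all add: power_mono)
  ultimately show ?thesis by linarith
qed

text \<open>Steps proportional to 1 / sqrt t weight the differences of E by a growing factor, so the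
  sum does not telescope directly; each increase of the weight is paid for by E n \<le> 4 R^2. The
  factor 3 is 1 for this diameter term plus 2 for the sum of the 1 / sqrt t.\<close>

lemma ogd_telescope:
  fixes A E :: "nat \<Rightarrow> real"
  assumes R: "0 < R" and B: "0 \<le> B"
    and A: "\<And>n. n < T \<Longrightarrow> A n \<le> B / (4 * R) * sqrt (Suc n) * (E n - E (Suc n)) + R * B / sqrt (Suc n)"
    and E: "\<And>n. 0 \<le> E n" "\<And>n. E n \<le> 4 * R\<^sup>2"
  shows "(\<Sum>n<T. A n) \<le> 3 * R * B * sqrt T"
proof -
  define c where "c = B / (4 * R)"
  have c: "0 \<le> c" using R B by (simp add: c_def)
  \<comment> \<open>Summation by parts as an invariant: the term - E n is kept so that the next
    difference can cancel against it, at the cost of (sqrt (Suc n) - sqrt n) * 4 R^2.\<close>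
  have "n \<le> T \<Longrightarrow> (\<Sum>j<n. A j) \<le> c * (sqrt n * (4 * R\<^sup>2 - E n)) + 2 * R * B * sqrt n" for n
  proof (induction n)
    case (Suc n)
    have mono: "sqrt n \<le> sqrt (Suc n)" by simp
    have s: "1 / sqrt (Suc n) \<le> 2 * (sqrt (Suc n) - sqrt n)"
    proof -
      have "1 = (sqrt (Suc n) - sqrt n) * (sqrt (Suc n) + sqrt n)"
        by (simp add: algebra_simps)
      also have "\<dots> \<le> (sqrt (Suc n) - sqrt n) * (2 * sqrt (Suc n))"
        using mono by (intro mult_left_mono) auto
      finally have "1 \<le> (2 * (sqrt (Suc n) - sqrt n)) * sqrt (Suc n)" by (simp only: mult_ac)
      then show ?thesis by (subst divide_le_eq) simp
    qed
    have "(sqrt (Suc n) - sqrt n) * E n \<le> (sqrt (Suc n) - sqrt n) * (4 * R\<^sup>2)"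
      using mono E by (intro mult_left_mono) auto
    then have "c * (sqrt (Suc n) * (E n - E (Suc n)) + sqrt n * (4 * R\<^sup>2 - E n))
        \<le> c * (sqrt (Suc n) * (4 * R\<^sup>2 - E (Suc n)))"
      using c by (intro mult_left_mono) (auto simp: algebra_simps)
    moreover have "R * B / sqrt (Suc n) \<le> R * B * (2 * (sqrt (Suc n) - sqrt n))"
      using mult_left_mono[OF s, of "R * B"] R B by simp
    moreover have "A n \<le> c * sqrt (Suc n) * (E n - E (Suc n)) + R * B / sqrt (Suc n)"
      using A Suc.prems by (simp add: c_def)
    ultimately show ?case using Suc by (simp add: algebra_simps)
  qed simp
  from this[of T] have "(\<Sum>n<T. A n) \<le> c * (sqrt T * (4 * R\<^sup>2 - E T)) + 2 * R * B * sqrt T"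
    by simp
  also have "\<dots> \<le> c * (sqrt T * (4 * R\<^sup>2)) + 2 * R * B * sqrt T"
    using c E[of T] by (intro add_right_mono mult_left_mono) auto
  also have "\<dots> = 3 * R * B * sqrt T"
    using R by (simp add: c_def power2_eq_square)
  finally show ?thesis .
qed

section \<open>Linearisation of the network and regret against a fixed parameter\<close>

lemma net_in_vspace: "net \<sigma> p d m b a \<theta> x \<in> vspace d"
  by (simp add: net_def vspace_def)

lemma ip_diff_left: "ip p (\<lambda>k. u k - v k) x = ip p u x - ip p v x"
  by (simp add: ip_def sum_subtractf left_diff_distrib)

definition net_lin :: "(real \<Rightarrow> real) \<Rightarrow> nat \<Rightarrow> nat \<Rightarrow> real \<Rightarrow> (nat \<Rightarrow> nat \<Rightarrow> real)
    \<Rightarrow> params \<Rightarrow> params \<Rightarrow> (nat \<Rightarrow> real) \<Rightarrow> nat \<Rightarrow> real" where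
  "net_lin \<sigma> p m b a \<theta> \<theta>' x i =
     (1 / b) * (\<Sum>r<m. a i r * deriv \<sigma> (ip p (\<theta> i r) x) * ip p (\<lambda>k. \<theta>' i r k - \<theta> i r k) x)"

text \<open>A unit input changes each preactivation by at most the norm of the row's displacement,
  so the bounds on the quadratic remainders of all rows add up to a multiple of the squared
  Frobenius distance. Summing absolute values over the outputs therefore costs no factor d, and this
  sum dominates the Euclidean norm used later.\<close>

lemma net_linearization_error:
  assumes diff: "\<And>z. \<sigma> differentiable (at z)"
    and lip: "\<And>z z'. \<bar>deriv \<sigma> z - deriv \<sigma> z'\<bar> \<le> C * \<bar>z - z'\<bar>"
    and b: "0 < b" and a: "\<And>i r. i < d \<Longrightarrow> r < m \<Longrightarrow> \<bar>a i r\<bar> = 1" and x: "vnorm p x = 1"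
  shows "(\<Sum>i<d. \<bar>net \<sigma> p d m b a \<theta>' x i - net \<sigma> p d m b a \<theta> x i - net_lin \<sigma> p m b a \<theta> \<theta>' x i\<bar>)
    \<le> C / b * (frob p d m \<theta>' \<theta>)\<^sup>2"
proof -
  have C: "0 \<le> C" using lip[of 1 0] by simp
  have "\<bar>net \<sigma> p d m b a \<theta>' x i - net \<sigma> p d m b a \<theta> x i - net_lin \<sigma> p m b a \<theta> \<theta>' x i\<bar>
      \<le> C / b * (\<Sum>r<m. (vnorm p (\<lambda>k. \<theta>' i r k - \<theta> i r k))\<^sup>2)" if i: "i < d" for i
  proof -
    let ?e = "\<lambda>r. a i r * (\<sigma> (ip p (\<theta>' i r) x) - \<sigma> (ip p (\<theta> i r) x)
        - deriv \<sigma> (ip p (\<theta> i r) x) * (ip p (\<theta>' i r) x - ip p (\<theta> i r) x))"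
    have e: "\<bar>?e r\<bar> \<le> C * (vnorm p (\<lambda>k. \<theta>' i r k - \<theta> i r k))\<^sup>2" if r: "r < m" for r
    proof -
      have "\<bar>?e r\<bar> \<le> C * (ip p (\<theta>' i r) x - ip p (\<theta> i r) x)\<^sup>2"
        using lipschitz_derivative_remainder[OF diff lip] a[OF i r] by (simp add: abs_mult)
      also have "\<dots> \<le> C * (vnorm p (\<lambda>k. \<theta>' i r k - \<theta> i r k))\<^sup>2"
        using abs_ip_le[of p "\<lambda>k. \<theta>' i r k - \<theta> i r k" x] x C
        by (intro mult_left_mono) (auto simp: ip_diff_left intro!: abs_le_square_iff[THEN iffD1])
      finally show ?thesis .
    qed
    have "net \<sigma> p d m b a \<theta>' x i - net \<sigma> p d m b a \<theta> x i - net_lin \<sigma> p m b a \<theta> \<theta>' x i = (1 / b) * (\<Sum>r<m. ?e r)"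
      using i by (simp add: net_def net_lin_def ip_diff_left right_diff_distrib sum_subtractf sum_distrib_left mult.assoc)
    then have "\<bar>net \<sigma> p d m b a \<theta>' x i - net \<sigma> p d m b a \<theta> x i - net_lin \<sigma> p m b a \<theta> \<theta>' x i\<bar> = (1 / b) * \<bar>\<Sum>r<m. ?e r\<bar>"
      using b by (simp add: abs_mult)
    also have "\<dots> \<le> (1 / b) * (\<Sum>r<m. C * (vnorm p (\<lambda>k. \<theta>' i r k - \<theta> i r k))\<^sup>2)"
      using b by (intro mult_left_mono order_trans[OF sum_abs] sum_mono e) auto
    finally show ?thesis by (simp add: sum_distrib_left)
  qed
  then have "(\<Sum>i<d. \<bar>net \<sigma> p d m b a \<theta>' x i - net \<sigma> p d m b a \<theta> x i - net_lin \<sigma> p m b a \<theta> \<theta>' x i\<bar>)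
    \<le> (\<Sum>i<d. C / b * (\<Sum>r<m. (vnorm p (\<lambda>k. \<theta>' i r k - \<theta> i r k))\<^sup>2))"
    by (intro sum_mono) auto
  also have "\<dots> = C / b * (frob p d m \<theta>' \<theta>)\<^sup>2"
    by (simp add: frob_def sum_distrib_left sum_nonneg)
  finally show ?thesis .
qed

text \<open>The chain rule for the composed loss, whose gradient is given by an explicit formula: a
  displacement is seen only through the first-order change of the network.\<close>

lemma pip_net_loss_grad:
  "pip p d m (net_loss_grad \<sigma> p d m b a F \<theta> x) (\<theta>' - \<theta>)
     = ip d (grad_vec d F (net \<sigma> p d m b a \<theta> x)) (net_lin \<sigma> p m b a \<theta> \<theta>' x)"
  by (simp add: pip_def net_loss_grad_def ip_def net_lin_def sum_distrib_left mult_ac)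

text \<open>This is where the scaling b = sqrt m pays off: 1 / b^2 cancels the number m of rows, so
  the bound depends neither on m nor on d.\<close>

lemma pip_net_loss_grad_self_le:
  assumes bound: "\<And>z. \<bar>deriv \<sigma> z\<bar> \<le> C" and m: "0 < m" and b: "b = sqrt (real m)"
    and a: "\<And>i r. i < d \<Longrightarrow> r < m \<Longrightarrow> \<bar>a i r\<bar> = 1" and x: "vnorm p x = 1"
    and g: "vnorm d (grad_vec d F (net \<sigma> p d m b a \<theta> x)) \<le> L"
  shows "pip p d m (net_loss_grad \<sigma> p d m b a F \<theta> x) (net_loss_grad \<sigma> p d m b a F \<theta> x) \<le> (C * L)\<^sup>2"
proof -
  let ?v = "grad_vec d F (net \<sigma> p d m b a \<theta> x)"
  have x1: "(\<Sum>k<p. (x k)\<^sup>2) = 1" using x power2_vnorm[of p x] by simp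
  have "pip p d m (net_loss_grad \<sigma> p d m b a F \<theta> x) (net_loss_grad \<sigma> p d m b a F \<theta> x)
     = (\<Sum>i<d. \<Sum>r<m. \<Sum>k<p. (?v i)\<^sup>2 * (1 / m) * (a i r)\<^sup>2 * (deriv \<sigma> (ip p (\<theta> i r) x))\<^sup>2 * (x k)\<^sup>2)"
    by (simp add: pip_def net_loss_grad_def b power2_eq_square field_simps)
  also have "\<dots> = (\<Sum>i<d. \<Sum>r<m. (?v i)\<^sup>2 * (1 / m) * (a i r)\<^sup>2 * (deriv \<sigma> (ip p (\<theta> i r) x))\<^sup>2)"
    by (simp only: sum_distrib_left[symmetric] x1) simp
  also have "\<dots> \<le> (\<Sum>i<d. \<Sum>r<m. (?v i)\<^sup>2 * (1 / m) * 1 * C\<^sup>2)"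
  proof (intro sum_mono mult_mono mult_left_mono)
    fix i r assume ir: "i \<in> {..<d}" "r \<in> {..<m}"
    show "(a i r)\<^sup>2 \<le> 1" using a[of i r] ir by (metis lessThan_iff one_power2 order_refl power2_abs)
    show "(deriv \<sigma> (ip p (\<theta> i r) x))\<^sup>2 \<le> C\<^sup>2"
      using bound by (metis abs_ge_zero power2_abs power_mono)
  qed auto
  also have "\<dots> = C\<^sup>2 * (vnorm d ?v)\<^sup>2"
    using m by (simp add: power2_vnorm sum_distrib_left mult_ac)
  also have "\<dots> \<le> C\<^sup>2 * L\<^sup>2"
    using g by (intro mult_left_mono power_mono) auto
  finally show ?thesis by (simp add: power_mult_distrib)
qed

lemma ogd_in_ball:
  "0 \<le> R \<Longrightarrow> frob p d m (ogd \<sigma> p d m b a \<theta>1 R \<eta> ell x n) \<theta>1 \<le> R"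
proof (cases n)
  case 0
  assume "0 \<le> R"
  with 0 show ?thesis by (simp add: frob_def vnorm_def)
qed (simp add: Let_def frob_proj_ball_le)

text \<open>Projection does not increase the distance to \<theta>s, and expanding the squared
  distance of the unprojected step isolates the inner product with G.\<close>

lemma ogd_step_inequality:
  fixes G \<theta> \<theta>s :: params
  assumes "0 \<le> R" "frob p d m \<theta>s \<theta>1 \<le> R" "0 < h" "pip p d m G G \<le> Q"
  shows "pip p d m G (\<theta> - \<theta>s) \<le> ((frob p d m \<theta> \<theta>s)\<^sup>2
      - (frob p d m (proj_ball p d m \<theta>1 R (\<lambda>i r k. \<theta> i r k - h * G i r k)) \<theta>s)\<^sup>2) / (2 * h) + h * Q / 2"
proof -
  let ?u = "\<lambda>i r k. \<theta> i r k - h * G i r k"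
  have eq: "?u - \<theta>s = (\<theta> - \<theta>s) - (\<lambda>i r k. h * G i r k)"
    by (simp add: fun_eq_iff)
  have "(frob p d m (proj_ball p d m \<theta>1 R ?u) \<theta>s)\<^sup>2 \<le> (frob p d m ?u \<theta>s)\<^sup>2"
    by (rule frob_proj_ball_contract) fact+
  also have "\<dots> = (frob p d m \<theta> \<theta>s)\<^sup>2 - 2 * (h * pip p d m G (\<theta> - \<theta>s)) + h * (h * pip p d m G G)"
    unfolding power2_frob eq power2_frob_minus[of p d m "\<theta> - \<theta>s" "\<lambda>i r k. h * G i r k"]
      pip_scale_left pip_scale_right pip_commute[of p d m "\<theta> - \<theta>s" G] ..
  also have "h * (h * pip p d m G G) \<le> h * (h * Q)"
    using assms by (intro mult_left_mono) auto
  finally have "2 * h * pip p d m G (\<theta> - \<theta>s) \<le> (frob p d m \<theta> \<theta>s)\<^sup>2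
      - (frob p d m (proj_ball p d m \<theta>1 R ?u) \<theta>s)\<^sup>2 + h * h * Q"
    unfolding mult.assoc by linarith
  then have "pip p d m G (\<theta> - \<theta>s) \<le> ((frob p d m \<theta> \<theta>s)\<^sup>2
      - (frob p d m (proj_ball p d m \<theta>1 R ?u) \<theta>s)\<^sup>2 + h * h * Q) / (2 * h)"
    using assms(3) by (subst pos_le_divide_eq) (simp_all only: mult_ac mult_pos_pos zero_less_numeral)
  then show ?thesis using assms(3) by (simp add: add_divide_distrib)
qed

text \<open>The targets y t may be arbitrary vectors, not outputs of some network: the discrepancy
  at \<theta>s is charged separately, at rate L. The factor 4 comes from linearising at the current
  iterate, which can be a full diameter 2 * R away from \<theta>s.\<close>

lemma ogd_regret:
  assumes diff: "\<And>z. \<sigma> differentiable (at z)"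
    and lip: "\<And>z z'. \<bar>deriv \<sigma> z - deriv \<sigma> z'\<bar> \<le> C * \<bar>z - z'\<bar>"
    and bound: "\<And>z. \<bar>deriv \<sigma> z\<bar> \<le> C" and C: "0 < C" and L: "0 < L" and R: "0 < R"
    and m: "0 < m" and b: "b = sqrt (real m)"
    and a: "\<And>i r. i < d \<Longrightarrow> r < m \<Longrightarrow> \<bar>a i r\<bar> = 1"
    and x: "\<And>t. t \<in> {1..T} \<Longrightarrow> vnorm p (x t) = 1"
    and cvx: "\<And>t. t \<in> {1..T} \<Longrightarrow> convex_vec d (ell t)"
    and dif: "\<And>t. t \<in> {1..T} \<Longrightarrow> differentiable_vec d (ell t)"
    and lipl: "\<And>t. t \<in> {1..T} \<Longrightarrow> lipschitz_vec d L (ell t)"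
    and \<theta>s: "frob p d m \<theta>s \<theta>1 \<le> R"
    and y: "\<And>t. t \<in> {1..T} \<Longrightarrow> y t \<in> vspace d"
    and \<eta>: "\<eta> = (\<lambda>t::nat. 2 * R / (C * L) * (real t) powr (-1/2))"
  shows "(\<Sum>t=1..T. ell t (net \<sigma> p d m b a (ogd \<sigma> p d m b a \<theta>1 R \<eta> ell x (t - 1)) (x t)))
    \<le> (\<Sum>t=1..T. ell t (y t)) + 3 * R * (C * L) * sqrt T + T * (L * (4 * C * R\<^sup>2 / b))
      + L * (\<Sum>t=1..T. vnorm d (\<lambda>i. net \<sigma> p d m b a \<theta>s (x t) i - y t i))"
proof -
  define \<theta> where "\<theta> = ogd \<sigma> p d m b a \<theta>1 R \<eta> ell x"
  define f where "f = (\<lambda>n \<theta>. net \<sigma> p d m b a \<theta> (x (Suc n)))"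
  define G where "G = (\<lambda>n. net_loss_grad \<sigma> p d m b a (ell (Suc n)) (\<theta> n) (x (Suc n)))"
  define E where "E = (\<lambda>n. (frob p d m (\<theta> n) \<theta>s)\<^sup>2)"
  define A where "A = (\<lambda>n. pip p d m (G n) (\<theta> n - \<theta>s))"
  have b0: "0 < b" using m b by simp
  have E: "E n \<le> 4 * R\<^sup>2" for n
    unfolding E_def \<theta>_def using R by (intro frob_triangle_power2[OF ogd_in_ball \<theta>s]) auto
  have grad: "has_grad_vec d (ell (Suc n)) (f n (\<theta> n)) (grad_vec d (ell (Suc n)) (f n (\<theta> n)))" if "n < T" for n
    using that dif[of "Suc n"] by (intro has_grad_vec_grad_vec) (auto simp: f_def net_in_vspace)
  have gradL: "vnorm d (grad_vec d (ell (Suc n)) (f n (\<theta> n))) \<le> L" if "n < T" for n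
    by (rule lipschitz_vec_grad_bound[OF _ grad[OF that]])
      (use that L lipl[of "Suc n"] in \<open>auto simp: f_def net_in_vspace\<close>)
  have A: "A n \<le> (C * L) / (4 * R) * sqrt (Suc n) * (E n - E (Suc n)) + R * (C * L) / sqrt (Suc n)"
    if n: "n < T" for n
  proof -
    have h: "\<eta> (Suc n) = 2 * R / (C * L) / sqrt (Suc n)"
      by (simp add: \<eta> powr_minus_divide powr_half_sqrt)
    have h0: "0 < \<eta> (Suc n)" unfolding h using R C L by simp
    have "pip p d m (G n) (G n) \<le> (C * L)\<^sup>2"
      unfolding G_def using gradL[OF n] n x[of "Suc n"]
      by (intro pip_net_loss_grad_self_le bound m b a) (auto simp: f_def)
    then have "A n \<le> (E n - E (Suc n)) / (2 * \<eta> (Suc n)) + \<eta> (Suc n) * (C * L)\<^sup>2 / 2"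
      using ogd_step_inequality[of R p d m \<theta>s \<theta>1 "\<eta> (Suc n)" "G n" "(C * L)\<^sup>2" "\<theta> n"] R \<theta>s h0
      by (simp add: A_def E_def \<theta>_def Let_def G_def)
    also have "\<dots> = (C * L) / (4 * R) * sqrt (Suc n) * (E n - E (Suc n)) + R * (C * L) / sqrt (Suc n)"
      unfolding h using R C L by (simp add: field_simps power2_eq_square)
    finally show ?thesis .
  qed
  have sumA: "(\<Sum>n<T. A n) \<le> 3 * R * (C * L) * sqrt T"
    using ogd_telescope[OF R _ A _ E] C L by (simp add: E_def)
  have round: "ell (Suc n) (f n (\<theta> n)) \<le> ell (Suc n) (y (Suc n)) + A n + L * (4 * C * R\<^sup>2 / b)
      + L * vnorm d (\<lambda>i. f n \<theta>s i - y (Suc n) i)" if n: "n < T" for n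
  proof -
    let ?v = "grad_vec d (ell (Suc n)) (f n (\<theta> n))"
    let ?lin = "net_lin \<sigma> p m b a (\<theta> n) \<theta>s (x (Suc n))"
    let ?rem = "\<lambda>i. f n \<theta>s i - f n (\<theta> n) i - ?lin i"
    have "ell (Suc n) (f n (\<theta> n)) - ell (Suc n) (y (Suc n)) \<le> ip d ?v (\<lambda>k. f n (\<theta> n) k - y (Suc n) k)"
      using n cvx[of "Suc n"] y[of "Suc n"]
      by (intro convex_vec_grad_le grad) (auto simp: f_def net_in_vspace)
    \<comment> \<open>The gap splits as f \<theta> - y = - lin - rem + (f \<theta>s - y): the first
      term is what descent controls, the second is the linearisation error, the third the
      approximation error.\<close>
    also have "\<dots> = - ip d ?v ?lin + ip d ?v (\<lambda>i. - ?rem i) + ip d ?v (\<lambda>i. f n \<theta>s i - y (Suc n) i)"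
      by (simp add: ip_def sum.distrib[symmetric] sum_subtractf[symmetric] sum_negf[symmetric] algebra_simps)
    also have "- ip d ?v ?lin = A n"
    proof -
      have "\<theta> n - \<theta>s = (\<lambda>i r k. (-1) * (\<theta>s - \<theta> n) i r k)" by (simp add: fun_eq_iff)
      then have "A n = - pip p d m (G n) (\<theta>s - \<theta> n)"
        unfolding A_def by (simp only: pip_scale_right)
      then show ?thesis by (simp add: G_def pip_net_loss_grad f_def)
    qed
    also have "ip d ?v (\<lambda>i. - ?rem i) \<le> L * (4 * C * R\<^sup>2 / b)"
    proof -
      have "ip d ?v (\<lambda>i. - ?rem i) \<le> vnorm d ?v * vnorm d (\<lambda>i. - ?rem i)"
        using abs_ip_le abs_le_D1 by blast
      also have "\<dots> \<le> L * (\<Sum>i<d. \<bar>- ?rem i\<bar>)"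
        using gradL[OF n] L by (intro mult_mono vnorm_le_sum) auto
      also have "(\<Sum>i<d. \<bar>- ?rem i\<bar>) = (\<Sum>i<d. \<bar>?rem i\<bar>)"
        by (simp only: abs_minus_cancel)
      also have "(\<Sum>i<d. \<bar>?rem i\<bar>) \<le> C / b * (frob p d m \<theta>s (\<theta> n))\<^sup>2"
        unfolding f_def using n x[of "Suc n"]
        by (intro net_linearization_error diff lip b0 a) auto
      also have "(frob p d m \<theta>s (\<theta> n))\<^sup>2 \<le> 4 * R\<^sup>2"
        unfolding \<theta>_def using R by (intro frob_triangle_power2[OF \<theta>s ogd_in_ball]) auto
      finally show ?thesis using L C b0 by (simp add: field_simps)
    qed
    also have "ip d ?v (\<lambda>i. f n \<theta>s i - y (Suc n) i) \<le> L * vnorm d (\<lambda>i. f n \<theta>s i - y (Suc n) i)"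
    proof -
      have "ip d ?v (\<lambda>i. f n \<theta>s i - y (Suc n) i) \<le> vnorm d ?v * vnorm d (\<lambda>i. f n \<theta>s i - y (Suc n) i)"
        using abs_ip_le abs_le_D1 by blast
      also have "\<dots> \<le> L * vnorm d (\<lambda>i. f n \<theta>s i - y (Suc n) i)"
        using gradL[OF n] by (intro mult_right_mono) auto
      finally show ?thesis .
    qed
    finally show ?thesis by simp
  qed
  \<comment> \<open>Iterate n of \<open>ogd\<close> is the one played in round Suc n, against loss
    Suc n.\<close>
  have shift: "(\<Sum>t=1..T. h t) = (\<Sum>n<T. h (Suc n))" for h :: "nat \<Rightarrow> real"
    by (simp add: sum.atLeast1_atMost_eq)
  have "(\<Sum>n<T. ell (Suc n) (f n (\<theta> n))) \<le> (\<Sum>n<T. ell (Suc n) (y (Suc n)) + A n + L * (4 * C * R\<^sup>2 / b)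
      + L * vnorm d (\<lambda>i. f n \<theta>s i - y (Suc n) i))"
    by (intro sum_mono round) auto
  also have "\<dots> = (\<Sum>n<T. ell (Suc n) (y (Suc n))) + (\<Sum>n<T. A n) + T * (L * (4 * C * R\<^sup>2 / b))
      + L * (\<Sum>n<T. vnorm d (\<lambda>i. f n \<theta>s i - y (Suc n) i))"
    by (simp add: sum.distrib sum_distrib_left)
  also have "\<dots> \<le> (\<Sum>n<T. ell (Suc n) (y (Suc n))) + 3 * R * (C * L) * sqrt T + T * (L * (4 * C * R\<^sup>2 / b))
      + L * (\<Sum>n<T. vnorm d (\<lambda>i. f n \<theta>s i - y (Suc n) i))"
    using sumA by simp
  finally show ?thesis unfolding shift by (simp add: f_def \<theta>_def)
qed

section \<open>Measurability of the iterates\<close>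

text \<open>F is constrained only on \<open>vspace n\<close>, so it is precomposed with the
  truncation to n coordinates. That composition is continuous for the product topology, because
  finitely many coordinates control it.\<close>

lemma borel_measurable_lipschitz_vec:
  assumes lip: "lipschitz_vec n L F"
    and Y: "\<And>k. k < n \<Longrightarrow> (\<lambda>\<omega>. Y \<omega> k) \<in> borel_measurable N" and Yv: "\<And>\<omega>. Y \<omega> \<in> vspace n"
  shows "(\<lambda>\<omega>. F (Y \<omega>)) \<in> borel_measurable N"
proof -
  define tr where "tr = (\<lambda>(y::nat \<Rightarrow> real) k. if k < n then y k else 0)"
  have tr: "tr y \<in> vspace n" for y by (simp add: tr_def vspace_def)
  have "isCont (\<lambda>y. F (tr y)) y" for y
  proof -
    have "continuous_on UNIV (\<lambda>z. tr z k)" for k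
      by (cases "k < n") (simp_all add: tr_def continuous_on_product_coordinates)
    then have "continuous_on UNIV (\<lambda>z. L * vnorm n (\<lambda>k. tr z k - tr y k))"
      unfolding vnorm_def by (intro continuous_intros)
    then have "isCont (\<lambda>z. L * vnorm n (\<lambda>k. tr z k - tr y k)) y"
      by (rule continuous_on_interior) simp
    then have "(\<lambda>z. L * vnorm n (\<lambda>k. tr z k - tr y k)) \<midarrow>y\<rightarrow> L * vnorm n (\<lambda>k. tr y k - tr y k)"
      unfolding isCont_def .
    then have lim: "(\<lambda>z. L * vnorm n (\<lambda>k. tr z k - tr y k)) \<midarrow>y\<rightarrow> 0" by (simp add: vnorm_def)
    have "norm (F (tr z) - F (tr y)) \<le> L * vnorm n (\<lambda>k. tr z k - tr y k)" for z
      using lip tr by (simp add: lipschitz_vec_def)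
    then have "(\<lambda>z. F (tr z) - F (tr y)) \<midarrow>y\<rightarrow> 0"
      by (intro Lim_null_comparison[OF _ lim]) (simp add: always_eventually)
    then show ?thesis unfolding isCont_def by (simp add: LIM_zero_iff)
  qed
  then have "continuous_on UNIV (\<lambda>y. F (tr y))"
    by (simp add: continuous_at_imp_continuous_on)
  then have F: "(\<lambda>y. F (tr y)) \<in> borel_measurable borel"
    by (rule borel_measurable_continuous_onI)
  have "(\<lambda>\<omega>. Y \<omega> k) \<in> borel_measurable N" for k
    using Y Yv by (cases "k < n") (auto simp: vspace_def)
  then have "Y \<in> borel_measurable N" by (rule measurable_coordinatewise_then_product)
  from measurable_compose[OF this F] have "(\<lambda>\<omega>. F (tr (Y \<omega>))) \<in> borel_measurable N" .
  moreover have "tr (Y \<omega>) = Y \<omega>" for \<omega> using Yv[of \<omega>] by (auto simp: tr_def vspace_def fun_eq_iff)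
  ultimately show ?thesis by simp
qed

text \<open>\<open>grad_vec\<close> is a choice, so measurability cannot be read off its definition.
  Each coordinate is instead the pointwise limit of difference quotients along the unit vector e
  with steps 1 / (j + 1).\<close>

lemma borel_measurable_grad_vec:
  assumes lip: "lipschitz_vec n L F" and diff: "differentiable_vec n F"
    and Y: "\<And>k. k < n \<Longrightarrow> (\<lambda>\<omega>. Y \<omega> k) \<in> borel_measurable N" and Yv: "\<And>\<omega>. Y \<omega> \<in> vspace n"
    and i: "i < n"
  shows "(\<lambda>\<omega>. grad_vec n F (Y \<omega>) i) \<in> borel_measurable N"
proof -
  define e where "e = (\<lambda>k::nat. if k = i then 1 else 0 :: real)"
  have e: "e \<in> vspace n" using i by (auto simp: e_def vspace_def)
  define u where "u = (\<lambda>j::nat. 1 / real (Suc j))"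
  have "(\<lambda>\<omega>. (F (\<lambda>k. Y \<omega> k + u j * e k) - F (Y \<omega>)) / u j) \<in> borel_measurable N" for j
  proof -
    have [measurable]: "(\<lambda>\<omega>. F (\<lambda>k. Y \<omega> k + u j * e k)) \<in> borel_measurable N"
      by (rule borel_measurable_lipschitz_vec[OF lip]) (use Y Yv e in \<open>auto simp: vspace_def\<close>)
    have [measurable]: "(\<lambda>\<omega>. F (Y \<omega>)) \<in> borel_measurable N"
      by (rule borel_measurable_lipschitz_vec[OF lip Y Yv])
    show ?thesis by measurable
  qed
  then show ?thesis
  proof (rule borel_measurable_LIMSEQ_real[rotated])
    fix \<omega>
    have "filterlim u (at 0) sequentially"
      unfolding u_def filterlim_at using LIMSEQ_inverse_real_of_nat by (auto simp: inverse_eq_divide)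
    from filterlim_compose[OF has_grad_vec_directional[OF has_grad_vec_grad_vec[OF diff Yv] e] this]
    have "(\<lambda>j. (F (\<lambda>k. Y \<omega> k + u j * e k) - F (Y \<omega>)) / u j) \<longlonglongrightarrow> ip n (grad_vec n F (Y \<omega>)) e" .
    moreover have "ip n (grad_vec n F (Y \<omega>)) e = grad_vec n F (Y \<omega>) i"
      using i by (simp add: ip_def e_def if_distrib cong: if_cong)
    ultimately show "(\<lambda>j. (F (\<lambda>k. Y \<omega> k + u j * e k) - F (Y \<omega>)) / u j) \<longlonglongrightarrow> grad_vec n F (Y \<omega>) i" by simp
  qed
qed

lemma borel_measurable_net:
  assumes \<sigma>: "\<sigma> \<in> borel_measurable borel"
    and A: "\<And>i r. i < d \<Longrightarrow> r < m \<Longrightarrow> (\<lambda>\<omega>. A \<omega> i r) \<in> borel_measurable N"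
    and \<theta>: "\<And>i r k. i < d \<Longrightarrow> r < m \<Longrightarrow> k < p \<Longrightarrow> (\<lambda>\<omega>. \<theta> \<omega> i r k) \<in> borel_measurable N"
    and i: "i < d"
  shows "(\<lambda>\<omega>. net \<sigma> p d m b (A \<omega>) (\<theta> \<omega>) x i) \<in> borel_measurable N"
proof -
  have "(\<lambda>\<omega>. ip p (\<theta> \<omega> i r) x) \<in> borel_measurable N" if "r < m" for r
    unfolding ip_def using \<theta>[OF i that] by (intro borel_measurable_sum borel_measurable_times) auto
  from measurable_compose[OF this \<sigma>] A[OF i] i show ?thesis
    unfolding net_def by (auto intro!: borel_measurable_sum borel_measurable_times)
qed

lemma borel_measurable_frob:
  assumes "\<And>i r k. i < d \<Longrightarrow> r < m \<Longrightarrow> k < p \<Longrightarrow> (\<lambda>\<omega>. \<theta> \<omega> i r k) \<in> borel_measurable N"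
    and "\<And>i r k. i < d \<Longrightarrow> r < m \<Longrightarrow> k < p \<Longrightarrow> (\<lambda>\<omega>. \<theta>' \<omega> i r k) \<in> borel_measurable N"
  shows "(\<lambda>\<omega>. frob p d m (\<theta> \<omega>) (\<theta>' \<omega>)) \<in> borel_measurable N"
proof -
  note assms[measurable]
  show ?thesis unfolding frob_def power2_vnorm by measurable
qed

text \<open>Induction over the rounds, stopped at T because only the losses 1 to T are assumed
  differentiable and Lipschitz: iterate n has used the losses 1 to n.\<close>

lemma borel_measurable_ogd:
  assumes \<sigma>: "\<sigma> \<in> borel_measurable borel" "deriv \<sigma> \<in> borel_measurable borel"
    and A: "\<And>i r. i < d \<Longrightarrow> r < m \<Longrightarrow> (\<lambda>\<omega>. A \<omega> i r) \<in> borel_measurable N"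
    and \<theta>1: "\<And>i r k. i < d \<Longrightarrow> r < m \<Longrightarrow> k < p \<Longrightarrow> (\<lambda>\<omega>. \<theta>1 \<omega> i r k) \<in> borel_measurable N"
    and dif: "\<And>t. t \<in> {1..T} \<Longrightarrow> differentiable_vec d (ell t)"
    and lip: "\<And>t. t \<in> {1..T} \<Longrightarrow> lipschitz_vec d L (ell t)"
  shows "n \<le> T \<Longrightarrow> i < d \<Longrightarrow> r < m \<Longrightarrow> k < p \<Longrightarrow>
    (\<lambda>\<omega>. ogd \<sigma> p d m b (A \<omega>) (\<theta>1 \<omega>) R \<eta> ell x n i r k) \<in> borel_measurable N"
proof (induction n arbitrary: i r k)
  case 0
  then show ?case using \<theta>1 by simp
next
  case (Suc n)
  define \<theta> where "\<theta> = (\<lambda>\<omega>. ogd \<sigma> p d m b (A \<omega>) (\<theta>1 \<omega>) R \<eta> ell x n)"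
  define u where "u = (\<lambda>\<omega> i r k. \<theta> \<omega> i r k - \<eta> (Suc n) *
    net_loss_grad \<sigma> p d m b (A \<omega>) (ell (Suc n)) (\<theta> \<omega>) (x (Suc n)) i r k)"
  have \<theta>: "(\<lambda>\<omega>. \<theta> \<omega> i r k) \<in> borel_measurable N" if "i < d" "r < m" "k < p" for i r k
    unfolding \<theta>_def using Suc that by simp
  have u: "(\<lambda>\<omega>. u \<omega> i r k) \<in> borel_measurable N" if ir: "i < d" "r < m" "k < p" for i r k
  proof -
    have [measurable]: "(\<lambda>\<omega>. grad_vec d (ell (Suc n)) (net \<sigma> p d m b (A \<omega>) (\<theta> \<omega>) (x (Suc n))) i) \<in> borel_measurable N"
      using Suc.prems(1) ir(1)
      by (intro borel_measurable_grad_vec[OF lip dif] borel_measurable_net \<sigma> A \<theta>) (auto simp: net_in_vspace)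
    have "(\<lambda>\<omega>. ip p (\<theta> \<omega> i r) (x (Suc n))) \<in> borel_measurable N"
      unfolding ip_def using \<theta> ir by (intro borel_measurable_sum borel_measurable_times) auto
    from measurable_compose[OF this \<sigma>(2)]
    have [measurable]: "(\<lambda>\<omega>. deriv \<sigma> (ip p (\<theta> \<omega> i r) (x (Suc n)))) \<in> borel_measurable N" .
    note A[OF ir(1,2), measurable] \<theta>[OF ir, measurable]
    show ?thesis unfolding u_def net_loss_grad_def by measurable
  qed
  have [measurable]: "(\<lambda>\<omega>. frob p d m (u \<omega>) (\<theta>1 \<omega>)) \<in> borel_measurable N"
    by (intro borel_measurable_frob u \<theta>1)
  note \<theta>1[OF Suc.prems(2-4), measurable] u[OF Suc.prems(2-4), measurable]
  have "(\<lambda>\<omega>. if frob p d m (u \<omega>) (\<theta>1 \<omega>) \<le> R then u \<omega> i r k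
      else \<theta>1 \<omega> i r k + (R / frob p d m (u \<omega>) (\<theta>1 \<omega>)) * (u \<omega> i r k - \<theta>1 \<omega> i r k)) \<in> borel_measurable N"
    by measurable
  also have "(\<lambda>\<omega>. if frob p d m (u \<omega>) (\<theta>1 \<omega>) \<le> R then u \<omega> i r k
      else \<theta>1 \<omega> i r k + (R / frob p d m (u \<omega>) (\<theta>1 \<omega>)) * (u \<omega> i r k - \<theta>1 \<omega> i r k))
    = (\<lambda>\<omega>. ogd \<sigma> p d m b (A \<omega>) (\<theta>1 \<omega>) R \<eta> ell x (Suc n) i r k)"
    by (simp add: fun_eq_iff Let_def proj_ball_def u_def \<theta>_def)
  finally show ?case .
qed

section \<open>Concentration of the root mean square error\<close>

text \<open>Hoeffding's lemma for each summand at tilt l / q, multiplied over independent summands.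
  The factor 2 pays for the absolute value, through
  \<open>exp \<bar>u\<bar> \<le> exp u + exp (- u)\<close>.\<close>

lemma (in prob_space) mgf_abs_mean_deviation_le:
  fixes X :: "nat \<Rightarrow> 'a \<Rightarrow> real"
  assumes q: "0 < q" and indep: "indep_vars (\<lambda>_. borel) X {..<q}"
    and X: "\<And>r \<omega>. r < q \<Longrightarrow> \<omega> \<in> space M \<Longrightarrow> \<bar>X r \<omega>\<bar> \<le> B"
    and mean: "\<And>r. r < q \<Longrightarrow> expectation (X r) = \<mu>" and l: "0 < l"
  shows "(\<integral>\<^sup>+\<omega>. exp (l * \<bar>(1 / q) * (\<Sum>r<q. X r \<omega>) - \<mu>\<bar>) \<partial>M) \<le> ennreal (2 * exp (l\<^sup>2 * B\<^sup>2 / (2 * q)))"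
proof -
  \<comment> \<open>A one-sided bound for an arbitrary family, since it is applied both to X and to
    - X.\<close>
  have one: "(\<integral>\<^sup>+\<omega>. exp (l * ((1 / q) * (\<Sum>r<q. Y r \<omega>) - \<nu>)) \<partial>M) \<le> ennreal (exp (l\<^sup>2 * B\<^sup>2 / (2 * q)))"
    if indep: "indep_vars (\<lambda>_. borel) Y {..<q}"
      and Y: "\<And>r \<omega>. r < q \<Longrightarrow> \<omega> \<in> space M \<Longrightarrow> \<bar>Y r \<omega>\<bar> \<le> B"
      and mean: "\<And>r. r < q \<Longrightarrow> expectation (Y r) = \<nu>" for Y :: "nat \<Rightarrow> 'a \<Rightarrow> real" and \<nu>
  proof -
    have rv: "random_variable borel (Y r)" if "r < q" for r
      using indep that by (auto simp: indep_vars_def)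
    have "(\<integral>\<^sup>+\<omega>. exp (l * ((1 / q) * (\<Sum>r<q. Y r \<omega>) - \<nu>)) \<partial>M)
        = (\<integral>\<^sup>+\<omega>. (\<Prod>r\<in>{..<q}. ennreal (exp ((l / q) * (Y r \<omega> - \<nu>)))) \<partial>M)"
    proof (intro nn_integral_cong)
      fix \<omega>
      have "l * ((1 / q) * (\<Sum>r<q. Y r \<omega>) - \<nu>) = (\<Sum>r<q. (l / q) * (Y r \<omega> - \<nu>))"
        unfolding sum_distrib_left[symmetric] sum_subtractf using q by (simp add: field_simps)
      then show "ennreal (exp (l * ((1 / q) * (\<Sum>r<q. Y r \<omega>) - \<nu>))) =
          (\<Prod>r\<in>{..<q}. ennreal (exp ((l / q) * (Y r \<omega> - \<nu>))))"
        by (simp add: exp_sum prod_ennreal)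
    qed
    also have "\<dots> = (\<Prod>r\<in>{..<q}. \<integral>\<^sup>+\<omega>. ennreal (exp ((l / q) * (Y r \<omega> - \<nu>))) \<partial>M)"
      by (intro indep_vars_nn_integral indep_vars_compose2[OF indep]) auto
    \<comment> \<open>The interval has length 2 * B, so each exponent is l^2 B^2 / (2 q^2), and q
      factors give l^2 B^2 / (2 q).\<close>
    also have "\<dots> \<le> (\<Prod>r\<in>{..<q}. ennreal (exp ((l / q)\<^sup>2 * (B - (- B))\<^sup>2 / 8)))"
    proof (intro prod_mono_ennreal)
      fix r assume "r \<in> {..<q}"
      then have r: "r < q" by simp
      interpret interval_bounded_random_variable M "Y r" "- B" B
      proof
        have "- B \<le> Y r \<omega> \<and> Y r \<omega> \<le> B" if "\<omega> \<in> space M" for \<omega>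
          using Y[OF r that] by (simp add: abs_le_iff)
        then show "AE \<omega> in M. Y r \<omega> \<in> {- B..B}" by (intro AE_I2) simp
      qed (rule rv[OF r])
      show "(\<integral>\<^sup>+\<omega>. ennreal (exp ((l / q) * (Y r \<omega> - \<nu>))) \<partial>M) \<le> ennreal (exp ((l / q)\<^sup>2 * (B - (- B))\<^sup>2 / 8))"
        using Hoeffdings_lemma_nn_integral[of "l / q"] l q mean[OF r] by simp
    qed
    also have "\<dots> = ennreal (exp (l\<^sup>2 * B\<^sup>2 / (2 * q)))"
      using q by (simp add: prod_ennreal ennreal_power exp_of_nat_mult[symmetric] power2_eq_square field_simps)
    finally show ?thesis .
  qed
  have rv: "random_variable borel (X r)" if "r < q" for r
    using indep that by (auto simp: indep_vars_def)
  then have [measurable]: "(\<lambda>\<omega>. \<Sum>r<q. X r \<omega>) \<in> borel_measurable M"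
    by (intro borel_measurable_sum) auto
  have eq: "(1 / q) * (\<Sum>r<q. - X r \<omega>) - (- \<mu>) = - ((1 / q) * (\<Sum>r<q. X r \<omega>) - \<mu>)" for \<omega>
    by (simp add: sum_negf)
  have "(\<integral>\<^sup>+\<omega>. exp (l * \<bar>(1 / q) * (\<Sum>r<q. X r \<omega>) - \<mu>\<bar>) \<partial>M)
      \<le> (\<integral>\<^sup>+\<omega>. ennreal (exp (l * ((1 / q) * (\<Sum>r<q. X r \<omega>) - \<mu>)))
          + ennreal (exp (l * ((1 / q) * (\<Sum>r<q. - X r \<omega>) - (- \<mu>)))) \<partial>M)"
    unfolding eq by (intro nn_integral_mono) (auto simp: abs_if)
  also have "\<dots> = (\<integral>\<^sup>+\<omega>. exp (l * ((1 / q) * (\<Sum>r<q. X r \<omega>) - \<mu>)) \<partial>M)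
      + (\<integral>\<^sup>+\<omega>. exp (l * ((1 / q) * (\<Sum>r<q. - X r \<omega>) - (- \<mu>))) \<partial>M)"
    unfolding eq by (rule nn_integral_add) simp_all
  also have "\<dots> \<le> ennreal (exp (l\<^sup>2 * B\<^sup>2 / (2 * q))) + ennreal (exp (l\<^sup>2 * B\<^sup>2 / (2 * q)))"
  proof (intro add_mono one)
    show "indep_vars (\<lambda>_. borel) (\<lambda>r \<omega>. - X r \<omega>) {..<q}"
      by (intro indep_vars_compose2[OF indep]) simp
  qed (use indep X mean in auto)
  also have "\<dots> = ennreal (2 * exp (l\<^sup>2 * B\<^sup>2 / (2 * q)))"
    by (simp flip: ennreal_plus)
  finally show ?thesis by simp
qed

lemma convex_on_exp_sqrt: "convex_on {0..} (\<lambda>u::real. exp (sqrt (1 + u)))"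
proof (rule convex_on_realI[where f' = "\<lambda>u. exp (sqrt (1 + u)) / (2 * sqrt (1 + u))"])
  show "connected {0::real..}" by simp
  fix u :: real assume "u \<in> {0..}"
  then show "((\<lambda>u. exp (sqrt (1 + u))) has_real_derivative exp (sqrt (1 + u)) / (2 * sqrt (1 + u))) (at u)"
    by (auto intro!: derivative_eq_intros simp: field_simps)
next
  fix u v :: real assume uv: "u \<in> {0..}" "v \<in> {0..}" "u \<le> v"
  define s where "s = sqrt (1 + u)"
  define w where "w = sqrt (1 + v)"
  have s: "1 \<le> s" "s \<le> w" using uv by (simp_all add: s_def w_def)
  \<comment> \<open>Holds because s \<ge> 1; this is the only place where the shift inside the
    square root enters.\<close>
  have "w \<le> s * (1 + (w - s))"
    using mult_right_mono[of 1 s "w - s"] s by (simp add: algebra_simps)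
  also have "\<dots> \<le> s * exp (w - s)"
    using s by (intro mult_left_mono exp_ge_add_one_self) auto
  finally have "w * exp s \<le> (s * exp (w - s)) * exp s"
    by (intro mult_right_mono) auto
  also have "\<dots> = s * exp w" by (simp add: exp_diff)
  finally have "exp s / (2 * s) \<le> exp w / (2 * w)"
    using s by (simp add: field_simps)
  then show "exp (sqrt (1 + u)) / (2 * sqrt (1 + u)) \<le> exp (sqrt (1 + v)) / (2 * sqrt (1 + v))"
    by (simp add: s_def w_def)
qed

text \<open>Jensen's inequality at u = y^2; the shift is removed again by sqrt (1 + y^2) \<le> 1 +
  |y|, which is the factor exp 1.\<close>

lemma exp_rms_le_mean_exp:
  fixes y :: "'j \<Rightarrow> real"
  assumes J: "finite J" "J \<noteq> {}"
  shows "exp (sqrt ((1 / card J) * (\<Sum>j\<in>J. (y j)\<^sup>2))) \<le> exp 1 * ((1 / card J) * (\<Sum>j\<in>J. exp \<bar>y j\<bar>))"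
proof -
  have c: "0 < card J" using J by (simp add: card_gt_0_iff)
  have "exp (sqrt ((1 / card J) * (\<Sum>j\<in>J. (y j)\<^sup>2))) \<le> exp (sqrt (1 + (\<Sum>j\<in>J. (1 / card J) *\<^sub>R (y j)\<^sup>2)))"
    by (simp add: sum_distrib_left)
  also have "\<dots> \<le> (\<Sum>j\<in>J. (1 / card J) * exp (sqrt (1 + (y j)\<^sup>2)))"
    using c by (intro convex_on_sum[OF J convex_on_exp_sqrt]) auto
  also have "\<dots> \<le> (\<Sum>j\<in>J. (1 / card J) * (exp 1 * exp \<bar>y j\<bar>))"
  proof (intro sum_mono mult_left_mono)
    fix j
    have "sqrt (1 + (y j)\<^sup>2) \<le> sqrt 1 + sqrt ((y j)\<^sup>2)"
      by (rule sqrt_add_le_add_sqrt) auto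
    then show "exp (sqrt (1 + (y j)\<^sup>2)) \<le> exp 1 * exp \<bar>y j\<bar>"
      by (simp add: exp_add[symmetric])
  qed auto
  also have "\<dots> = exp 1 * ((1 / card J) * (\<Sum>j\<in>J. exp \<bar>y j\<bar>))"
    by (simp add: sum_distrib_left mult_ac)
  finally show ?thesis .
qed

text \<open>The index set enters only through an average, so the bound does not grow with its size
  and the Y j may depend on each other. Markov's inequality for exp (U / s), with U the root mean
  square, then gives the tail.\<close>

lemma (in prob_space) rms_tail_bound:
  fixes Y :: "'j \<Rightarrow> 'a \<Rightarrow> real"
  assumes J: "finite J" "J \<noteq> {}" and s: "0 < s" and \<delta>: "0 < \<delta>"
    and Y: "\<And>j. j \<in> J \<Longrightarrow> random_variable borel (Y j)"
    and mgf: "\<And>j. j \<in> J \<Longrightarrow> (\<integral>\<^sup>+\<omega>. exp ((1 / s) * \<bar>Y j \<omega>\<bar>) \<partial>M) \<le> ennreal K" and K: "0 < K"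
  shows "prob {\<omega> \<in> space M. sqrt ((1 / card J) * (\<Sum>j\<in>J. (Y j \<omega>)\<^sup>2)) \<le> s * ln (exp 1 * K / \<delta>)} \<ge> 1 - \<delta>"
proof -
  note Y[measurable]
  define U where "U = (\<lambda>\<omega>. sqrt ((1 / card J) * (\<Sum>j\<in>J. (Y j \<omega>)\<^sup>2)))"
  have [measurable]: "U \<in> borel_measurable M"
    unfolding U_def by measurable
  have c: "0 < card J" using J by (simp add: card_gt_0_iff)
  have U: "exp ((1 / s) * U \<omega>) \<le> exp 1 * ((1 / card J) * (\<Sum>j\<in>J. exp ((1 / s) * \<bar>Y j \<omega>\<bar>)))" for \<omega>
  proof -
    have "(1 / s) * U \<omega> = sqrt ((1 / s)\<^sup>2 * ((1 / card J) * (\<Sum>j\<in>J. (Y j \<omega>)\<^sup>2)))"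
      using s by (simp add: U_def real_sqrt_mult real_sqrt_divide)
    also have "\<dots> = sqrt ((1 / card J) * (\<Sum>j\<in>J. ((1 / s) * Y j \<omega>)\<^sup>2))"
      by (simp add: power_mult_distrib power_divide sum_distrib_left mult_ac)
    finally show ?thesis using exp_rms_le_mean_exp[OF J, of "\<lambda>j. (1 / s) * Y j \<omega>"] s
      by (simp add: abs_mult)
  qed
  have "(\<integral>\<^sup>+\<omega>. exp ((1 / s) * U \<omega>) \<partial>M)
      \<le> (\<integral>\<^sup>+\<omega>. ennreal (exp 1 * (1 / card J)) * (\<Sum>j\<in>J. ennreal (exp ((1 / s) * \<bar>Y j \<omega>\<bar>))) \<partial>M)"
    using U by (intro nn_integral_mono) (simp add: sum_nonneg mult.assoc flip: ennreal_mult ennreal_mult')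
  also have "\<dots> = ennreal (exp 1 * (1 / card J)) * (\<Sum>j\<in>J. \<integral>\<^sup>+\<omega>. exp ((1 / s) * \<bar>Y j \<omega>\<bar>) \<partial>M)"
    using Y by (subst nn_integral_cmult) (auto simp: nn_integral_sum simp del: sum_ennreal)
  also have "\<dots> \<le> ennreal (exp 1 * (1 / card J)) * (\<Sum>j\<in>J. ennreal K)"
    by (intro mult_left_mono sum_mono mgf) auto
  also have "\<dots> = ennreal (exp 1 * (1 / card J)) * ennreal (card J * K)"
    using K by (simp add: ennreal_mult ennreal_of_nat_eq_real_of_nat)
  also have "\<dots> = ennreal (exp 1 * K)"
    using c K by (simp flip: ennreal_mult)
  finally have mgfU: "(\<integral>\<^sup>+\<omega>. exp ((1 / s) * U \<omega>) \<partial>M) \<le> ennreal (exp 1 * K)" .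
  let ?bad = "{\<omega> \<in> space M. exp 1 * K / \<delta> < exp ((1 / s) * U \<omega>)}"
  have "emeasure M ?bad \<le> emeasure M {\<omega> \<in> space M. 1 \<le> ennreal (\<delta> / (exp 1 * K)) * ennreal (exp ((1 / s) * U \<omega>))}"
  proof (intro emeasure_mono subsetI)
    fix \<omega> assume "\<omega> \<in> ?bad"
    then have "\<omega> \<in> space M" "1 \<le> \<delta> / (exp 1 * K) * exp ((1 / s) * U \<omega>)"
      using \<delta> K by (auto simp: field_simps)
    then show "\<omega> \<in> {\<omega> \<in> space M. 1 \<le> ennreal (\<delta> / (exp 1 * K)) * ennreal (exp ((1 / s) * U \<omega>))}"
      using \<delta> K by (simp add: ennreal_mult'[symmetric] del: ennreal_1 flip: ennreal_1)
  qed simp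
  also have "\<dots> \<le> ennreal (\<delta> / (exp 1 * K)) * (\<integral>\<^sup>+\<omega>. ennreal (exp ((1 / s) * U \<omega>)) * indicator (space M) \<omega> \<partial>M)"
    by (rule nn_integral_Markov_inequality) auto
  also have "\<dots> = ennreal (\<delta> / (exp 1 * K)) * (\<integral>\<^sup>+\<omega>. ennreal (exp ((1 / s) * U \<omega>)) \<partial>M)"
    by (intro arg_cong2[where f = "(*)"] nn_integral_cong) auto
  also have "\<dots> \<le> ennreal (\<delta> / (exp 1 * K)) * ennreal (exp 1 * K)"
    by (intro mult_left_mono mgfU) auto
  also have "\<dots> = ennreal \<delta>"
    using \<delta> K by (simp flip: ennreal_mult)
  finally have "prob ?bad \<le> \<delta>"
    using \<delta> by (simp add: emeasure_eq_measure)
  moreover have "prob {\<omega> \<in> space M. U \<omega> \<le> s * ln (exp 1 * K / \<delta>)} = 1 - prob ?bad"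
  proof -
    have "{\<omega> \<in> space M. U \<omega> \<le> s * ln (exp 1 * K / \<delta>)} = space M - ?bad"
    proof (intro set_eqI)
      fix \<omega>
      have "U \<omega> \<le> s * ln (exp 1 * K / \<delta>) \<longleftrightarrow> (1 / s) * U \<omega> \<le> ln (exp 1 * K / \<delta>)"
        using s by (simp add: field_simps)
      also have "\<dots> \<longleftrightarrow> exp ((1 / s) * U \<omega>) \<le> exp 1 * K / \<delta>"
        using K \<delta> by (subst ln_ge_iff) auto
      finally show "\<omega> \<in> {\<omega> \<in> space M. U \<omega> \<le> s * ln (exp 1 * K / \<delta>)} \<longleftrightarrow> \<omega> \<in> space M - ?bad" by auto
    qed
    then show ?thesis by (simp add: prob_compl)
  qed
  ultimately show ?thesis unfolding U_def by simp
qed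

section \<open>Random features\<close>

lemma p0_eq_prod: "p0 p w = (\<Prod>k<p. std_normal_density (w k))"
proof -
  have "(\<Prod>k<p. std_normal_density (w k)) = (1 / sqrt (2 * pi)) ^ p * exp (\<Sum>k<p. - (w k)\<^sup>2 / 2)"
    unfolding std_normal_density_def prod.distrib prod_constant by (simp add: exp_sum)
  also have "(1 / sqrt (2 * pi)) ^ p = (2 * pi) powr (- real p / 2)"
    by (simp add: powr_half_sqrt[symmetric] powr_minus_divide[symmetric] powr_realpow[symmetric] powr_powr
        flip: powr_minus_divide)
  also have "(\<Sum>k<p. - (w k)\<^sup>2 / 2) = - (\<Sum>k<p. (w k)\<^sup>2) / 2"
    by (simp add: sum_negf sum_divide_distrib)
  finally show ?thesis by (simp add: p0_def)
qed

lemma p0_pos [simp]: "0 < p0 p w"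
  by (simp add: p0_def)

lemma p0_nonneg [simp]: "0 \<le> p0 p w"
  by (simp add: less_imp_le)

lemma p0_measurable [measurable]: "p0 p \<in> borel_measurable (lebesgue_Rp p)"
  unfolding p0_eq_prod lebesgue_Rp_def by measurable

lemma ip_measurable [measurable]: "(\<lambda>w. ip p w x) \<in> borel_measurable (lebesgue_Rp p)"
  unfolding ip_def lebesgue_Rp_def by measurable

abbreviation gauss :: "nat \<Rightarrow> (nat \<Rightarrow> real) measure" where
  "gauss p \<equiv> PiM {..<p} (\<lambda>_. std_normal_distribution)"

text \<open>Links two descriptions of the Gaussian: rows are sampled from a product of normal laws,
  while random feature integrals are taken against Lebesgue measure with \<open>p0\<close> as
  reference density. Both sides are compared on boxes.\<close>

lemma gauss_eq_density: "gauss p = density (lebesgue_Rp p) (\<lambda>w. ennreal (p0 p w))"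
proof -
  interpret normal: prob_space std_normal_distribution
    by (rule prob_space_normal_density) simp
  interpret N: product_sigma_finite "\<lambda>_::nat. std_normal_distribution" ..
  interpret L: product_sigma_finite "\<lambda>_::nat. lborel :: real measure" ..
  show ?thesis
  proof (rule N.PiM_eqI[symmetric])
    show "sets (density (lebesgue_Rp p) (\<lambda>w. ennreal (p0 p w))) = sets (gauss p)"
      unfolding lebesgue_Rp_def sets_density by (intro sets_PiM_cong) auto
    fix A :: "nat \<Rightarrow> real set" assume A: "\<And>k. k \<in> {..<p} \<Longrightarrow> A k \<in> sets std_normal_distribution"
    then have A': "k < p \<Longrightarrow> A k \<in> sets borel" for k by simp
    have "emeasure (density (lebesgue_Rp p) (\<lambda>w. ennreal (p0 p w))) (Pi\<^sub>E {..<p} A)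
        = (\<integral>\<^sup>+w. ennreal (p0 p w) * indicator (Pi\<^sub>E {..<p} A) w \<partial>lebesgue_Rp p)"
      using A' by (intro emeasure_density) (auto simp: lebesgue_Rp_def intro!: sets_PiM_I_finite p0_measurable[unfolded lebesgue_Rp_def] measurable_compose[OF _ measurable_ennreal])
    also have "\<dots> = (\<integral>\<^sup>+w. (\<Prod>k\<in>{..<p}. ennreal (std_normal_density (w k)) * indicator (A k) (w k)) \<partial>PiM {..<p} (\<lambda>_. lborel))"
      unfolding lebesgue_Rp_def
    proof (intro nn_integral_cong)
      fix w assume w: "w \<in> space (PiM {..<p} (\<lambda>_. lborel :: real measure))"
      then have "indicator (Pi\<^sub>E {..<p} A) w = (\<Prod>k<p. indicator (A k) (w k) :: ennreal)"
        by (auto simp: space_PiM indicator_def PiE_iff prod_zero_iff)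
      then show "ennreal (p0 p w) * indicator (Pi\<^sub>E {..<p} A) w
          = (\<Prod>k\<in>{..<p}. ennreal (std_normal_density (w k)) * indicator (A k) (w k))"
        by (simp add: p0_eq_prod prod.distrib prod_ennreal)
    qed
    also have "\<dots> = (\<Prod>k\<in>{..<p}. \<integral>\<^sup>+z. ennreal (std_normal_density z) * indicator (A k) z \<partial>lborel)"
      using A' by (intro L.product_nn_integral_prod) auto
    also have "\<dots> = (\<Prod>k\<in>{..<p}. emeasure std_normal_distribution (A k))"
      using A' by (intro prod.cong) (auto simp: emeasure_density)
    finally show "emeasure (density (lebesgue_Rp p) (\<lambda>w. ennreal (p0 p w))) (Pi\<^sub>E {..<p} A)
        = (\<Prod>k\<in>{..<p}. emeasure std_normal_distribution (A k))" .
  qed simp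
qed

lemma prob_space_gauss: "prob_space (PiM I (\<lambda>_. std_normal_distribution))"
  by (intro prob_space_PiM prob_space_normal_density) simp

text \<open>The importance-weighted integrand: division by \<open>p0\<close> turns the Lebesgue
  integral defining a random feature function into an expectation over a Gaussian row.\<close>

definition rf_sample :: "(real \<Rightarrow> real) \<Rightarrow> nat \<Rightarrow> ((nat \<Rightarrow> real) \<Rightarrow> nat \<Rightarrow> real) \<Rightarrow> (nat \<Rightarrow> real) \<Rightarrow> (nat \<Rightarrow> real) \<Rightarrow> real" where
  "rf_sample \<sigma> p c x w = ip p (c w) x / p0 p w * deriv \<sigma> (ip p w x)"

lemma rf_sample_measurable:
  assumes "\<And>k. k < p \<Longrightarrow> (\<lambda>w. c w k) \<in> borel_measurable (lebesgue_Rp p)"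
    and "deriv \<sigma> \<in> borel_measurable borel"
  shows "rf_sample \<sigma> p c x \<in> borel_measurable (gauss p)"
proof -
  note assms[measurable]
  have "rf_sample \<sigma> p c x \<in> borel_measurable (lebesgue_Rp p)"
    unfolding rf_sample_def[abs_def] ip_def[of p "c _"] by measurable
  then show ?thesis by (simp add: gauss_eq_density)
qed

text \<open>The RF-norm controls precisely the importance weight; this boundedness is what makes
  Hoeffding's lemma applicable.\<close>

lemma abs_rf_sample_le:
  assumes "\<And>w. vnorm p (c w) / p0 p w \<le> D" "\<And>z. \<bar>deriv \<sigma> z\<bar> \<le> C" "vnorm p x = 1"
  shows "\<bar>rf_sample \<sigma> p c x w\<bar> \<le> C * D"
proof -
  have "\<bar>rf_sample \<sigma> p c x w\<bar> = \<bar>ip p (c w) x\<bar> / p0 p w * \<bar>deriv \<sigma> (ip p w x)\<bar>"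
    by (simp add: rf_sample_def abs_mult)
  also have "\<dots> \<le> (vnorm p (c w) / p0 p w) * \<bar>deriv \<sigma> (ip p w x)\<bar>"
    using abs_ip_le[of p "c w" x] assms(3) p0_pos[of p w]
    by (intro mult_right_mono divide_right_mono) auto
  also have "\<dots> \<le> D * C"
  proof (intro mult_mono assms)
    have "0 \<le> vnorm p (c w) / p0 p w" by simp
    then show "0 \<le> D" using assms(1)[of w] by linarith
  qed auto
  finally show ?thesis by (simp add: mult.commute)
qed

lemma integral_rf_sample:
  assumes "\<And>k. k < p \<Longrightarrow> (\<lambda>w. c w k) \<in> borel_measurable (lebesgue_Rp p)"
    and "deriv \<sigma> \<in> borel_measurable borel"
  shows "(LINT w|gauss p. rf_sample \<sigma> p c x w) = (LINT w|lebesgue_Rp p. ip p (c w) x * deriv \<sigma> (ip p w x))"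
proof -
  have "rf_sample \<sigma> p c x \<in> borel_measurable (lebesgue_Rp p)"
    using rf_sample_measurable[OF assms] by (simp add: gauss_eq_density)
  then have "(LINT w|gauss p. rf_sample \<sigma> p c x w) = (LINT w|lebesgue_Rp p. p0 p w *\<^sub>R rf_sample \<sigma> p c x w)"
    unfolding gauss_eq_density by (intro integral_density) auto
  also have "\<dots> = (LINT w|lebesgue_Rp p. ip p (c w) x * deriv \<sigma> (ip p w x))"
  proof (intro Bochner_Integration.integral_cong refl)
    fix w
    show "p0 p w *\<^sub>R rf_sample \<sigma> p c x w = ip p (c w) x * deriv \<sigma> (ip p w x)"
      using p0_pos[of p w] by (simp add: rf_sample_def del: p0_pos)
  qed
  finally show ?thesis .
qed

text \<open>The restriction, with value \<open>undefined\<close> outside \<open>{..<p}\<close>,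
  makes a row a point of the space of \<open>gauss p\<close>.\<close>

definition feature_row :: "nat \<Rightarrow> nat \<Rightarrow> nat \<Rightarrow> (nat \<times> nat \<times> nat \<Rightarrow> real) \<Rightarrow> nat \<Rightarrow> real" where
  "feature_row p i r G = (\<lambda>k\<in>{..<p}. G (i, r, k))"

lemma distr_row:
  assumes "i < d" "r < q"
  shows "distr (PiM ({..<d} \<times> {..<q} \<times> {..<p}) (\<lambda>_. std_normal_distribution)) (gauss p) (feature_row p i r) = gauss p"
  using distr_PiM_reindex[of "{..<d} \<times> {..<q} \<times> {..<p}" "\<lambda>_. std_normal_distribution" "\<lambda>k. (i, r, k)" "{..<p}"] assms
  by (auto simp: feature_row_def[abs_def] inj_on_def prob_space_normal_density)

lemma row_measurable:
  assumes "i < d" "r < q"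
  shows "feature_row p i r \<in> measurable (PiM ({..<d} \<times> {..<q} \<times> {..<p}) (\<lambda>_. std_normal_distribution)) (gauss p)"
  unfolding feature_row_def[abs_def] using assms by (intro measurable_restrict measurable_component_singleton) auto

lemma indep_vars_PiM_coordinates:
  assumes I: "I \<noteq> {}" and M: "\<And>i. i \<in> I \<Longrightarrow> prob_space (M i)"
  shows "prob_space.indep_vars (PiM I M) M (\<lambda>i \<omega>. \<omega> i) I"
proof -
  interpret prob_space "PiM I M" using M by (rule prob_space_PiM)
  have "distr (PiM I M) (PiM I M) (\<lambda>x. \<lambda>i\<in>I. x i) = distr (PiM I M) (PiM I M) (\<lambda>x. x)"
    by (intro distr_cong) (auto simp: space_PiM PiE_restrict)
  also have "\<dots> = PiM I M" by (simp add: distr_id)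
  also have "\<dots> = PiM I (\<lambda>i. distr (PiM I M) (M i) (\<lambda>x. x i))"
    using M by (intro PiM_cong) (auto simp: distr_PiM_component)
  finally show ?thesis
    by (subst indep_vars_iff_distr_eq_PiM'[OF I]) auto
qed

text \<open>Distinct rows use disjoint blocks of the independent coordinates; each block, still
  indexed by triples, is then relabelled by \<open>{..<p}\<close>.\<close>

lemma indep_vars_rows:
  assumes i: "i < d" and q: "0 < q" and p: "0 < p"
  shows "prob_space.indep_vars (PiM ({..<d} \<times> {..<q} \<times> {..<p}) (\<lambda>_. std_normal_distribution))
    (\<lambda>_. gauss p) (\<lambda>r. feature_row p i r) {..<q}"
proof -
  let ?I = "{..<d} \<times> {..<q} \<times> {..<p}"
  interpret prob_space "PiM ?I (\<lambda>_. std_normal_distribution)" by (rule prob_space_gauss)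
  have "indep_vars (\<lambda>_. std_normal_distribution) (\<lambda>j G. G j) ?I"
    by (rule indep_vars_PiM_coordinates) (use i q p in \<open>auto simp: prob_space_normal_density\<close>)
  then have "indep_vars (\<lambda>r. PiM ({i} \<times> {r} \<times> {..<p}) (\<lambda>_. std_normal_distribution))
      (\<lambda>r G. restrict (\<lambda>j. G j) ({i} \<times> {r} \<times> {..<p})) {..<q}"
    by (rule indep_vars_restrict) (use i in \<open>auto simp: disjoint_family_on_def\<close>)
  then have "indep_vars (\<lambda>_. gauss p)
      (\<lambda>r G. (\<lambda>h. \<lambda>k\<in>{..<p}. h (i, r, k)) (restrict (\<lambda>j. G j) ({i} \<times> {r} \<times> {..<p}))) {..<q}"
    by (rule indep_vars_compose2) (rule measurable_restrict, auto intro!: measurable_component_singleton)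
  also have "(\<lambda>r G. (\<lambda>h. \<lambda>k\<in>{..<p}. h (i, r, k)) (restrict (\<lambda>j. G j) ({i} \<times> {r} \<times> {..<p}))) = (\<lambda>r. feature_row p i r)"
    by (auto simp: feature_row_def fun_eq_iff restrict_def)
  finally show ?thesis .
qed

text \<open>The scale C * D / sqrt q makes Hoeffding's exponent equal to 1 / 2, and 2 * exp (1 / 2)
  \<le> 4 is the 4 in the logarithm. Independence is used only across the rows of one output at one
  input; the errors of different rounds share these rows.\<close>

lemma rf_rms_concentration:
  fixes h :: "nat \<Rightarrow> nat \<Rightarrow> real" and x :: "nat \<Rightarrow> nat \<Rightarrow> real"
  assumes pos: "0 < d" "0 < q" "0 < p" "0 < T" "0 < C" "0 < D" "0 < \<delta>"
    and c: "\<And>i k. i < d \<Longrightarrow> k < p \<Longrightarrow> (\<lambda>w. c i w k) \<in> borel_measurable (lebesgue_Rp p)"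
    and cD: "\<And>i w. i < d \<Longrightarrow> vnorm p (c i w) / p0 p w \<le> D"
    and \<sigma>: "deriv \<sigma> \<in> borel_measurable borel" "\<And>z. \<bar>deriv \<sigma> z\<bar> \<le> C"
    and x: "\<And>t. t \<in> {1..T} \<Longrightarrow> vnorm p (x t) = 1"
    and h: "\<And>i t. i < d \<Longrightarrow> t \<in> {1..T} \<Longrightarrow> h i t = (LINT w|lebesgue_Rp p. ip p (c i w) (x t) * deriv \<sigma> (ip p w (x t)))"
    and N: "N = PiM ({..<d} \<times> {..<q} \<times> {..<p}) (\<lambda>_. std_normal_distribution)"
    and err: "err = (\<lambda>i t G. (1 / real q) * (\<Sum>r<q. rf_sample \<sigma> p (c i) (x t) (feature_row p i r G)) - h i t)"
  shows "{G \<in> space N. sqrt ((1 / real (d * T)) * (\<Sum>i<d. \<Sum>t=1..T. (err i t G)\<^sup>2)) \<le> C * D / sqrt (real q) * ln (exp 1 * 4 / \<delta>)} \<in> sets N"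
    and "measure N {G \<in> space N. sqrt ((1 / real (d * T)) * (\<Sum>i<d. \<Sum>t=1..T. (err i t G)\<^sup>2)) \<le> C * D / sqrt (real q) * ln (exp 1 * 4 / \<delta>)} \<ge> 1 - \<delta>"
proof -
  interpret prob_space N unfolding N by (rule prob_space_gauss)
  let ?J = "{..<d} \<times> {1..T}"
  let ?s = "C * D / sqrt (real q)"
  let ?X = "\<lambda>i t r G. rf_sample \<sigma> p (c i) (x t) (feature_row p i r G)"
  have X: "?X i t r \<in> borel_measurable N" if "i < d" "r < q" for i t r
    using measurable_compose[OF row_measurable[OF that] rf_sample_measurable[OF c \<sigma>(1)]] that
    unfolding N by simp
  have err_meas: "err i t \<in> borel_measurable N" if "i < d" for i t
    unfolding err using X[OF that] by (intro borel_measurable_diff borel_measurable_times borel_measurable_sum) auto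
  have mgf: "(\<integral>\<^sup>+G. exp ((1 / ?s) * \<bar>err i t G\<bar>) \<partial>N) \<le> ennreal 4" if it: "i < d" "t \<in> {1..T}" for i t
  proof -
    have "(\<integral>\<^sup>+G. exp ((1 / ?s) * \<bar>(1 / real q) * (\<Sum>r<q. ?X i t r G) - h i t\<bar>) \<partial>N)
        \<le> ennreal (2 * exp ((1 / ?s)\<^sup>2 * (C * D)\<^sup>2 / (2 * real q)))"
    proof (rule mgf_abs_mean_deviation_le)
      have "indep_vars (\<lambda>_. gauss p) (\<lambda>r. feature_row p i r) {..<q}"
        unfolding N by (rule indep_vars_rows) (use it pos in auto)
      then show "indep_vars (\<lambda>_. borel) (?X i t) {..<q}"
        by (rule indep_vars_compose2) (intro rf_sample_measurable[OF c[OF it(1)] \<sigma>(1)])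
      show "\<bar>?X i t r G\<bar> \<le> C * D" for r G
        using abs_rf_sample_le[OF cD[OF it(1)] \<sigma>(2) x[OF it(2)]] .
      show "expectation (?X i t r) = h i t" if r: "r < q" for r
      proof -
        have "expectation (?X i t r) = (LINT w|distr N (gauss p) (feature_row p i r). rf_sample \<sigma> p (c i) (x t) w)"
          unfolding N by (intro integral_distr[symmetric] row_measurable rf_sample_measurable c \<sigma>(1)) (use it r in auto)
        also have "distr N (gauss p) (feature_row p i r) = gauss p"
          unfolding N by (rule distr_row) (use it r in auto)
        finally show ?thesis using h[OF it] integral_rf_sample[OF c[OF it(1)] \<sigma>(1)] by simp
      qed
    qed (use pos in auto)
    also have "(1 / ?s)\<^sup>2 * (C * D)\<^sup>2 / (2 * real q) = 1 / 2"
      using pos by (simp add: power_divide power_mult_distrib field_simps)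
    also have "ennreal (2 * exp (1 / 2)) \<le> ennreal 4"
      using exp_half_le2 by (intro ennreal_leI) simp
    finally show ?thesis by (simp add: err)
  qed
  have card: "card ?J = d * T" by simp
  have eq: "(\<Sum>i<d. \<Sum>t=1..T. (err i t G)\<^sup>2) = (\<Sum>j\<in>?J. (err (fst j) (snd j) G)\<^sup>2)" for G
    by (simp add: sum.cartesian_product case_prod_beta)
  have tail: "prob {G \<in> space N. sqrt ((1 / real (card ?J)) * (\<Sum>j\<in>?J. (err (fst j) (snd j) G)\<^sup>2)) \<le> ?s * ln (exp 1 * 4 / \<delta>)} \<ge> 1 - \<delta>"
    by (rule rms_tail_bound) (use pos err_meas mgf in auto)
  then show "measure N {G \<in> space N. sqrt ((1 / real (d * T)) * (\<Sum>i<d. \<Sum>t=1..T. (err i t G)\<^sup>2)) \<le> ?s * ln (exp 1 * 4 / \<delta>)} \<ge> 1 - \<delta>"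
    unfolding eq card by simp
  have [measurable]: "(\<lambda>G. \<Sum>i<d. \<Sum>t=1..T. (err i t G)\<^sup>2) \<in> borel_measurable N"
    unfolding eq using err_meas by (intro borel_measurable_sum borel_measurable_power) auto
  show "{G \<in> space N. sqrt ((1 / real (d * T)) * (\<Sum>i<d. \<Sum>t=1..T. (err i t G)\<^sup>2)) \<le> ?s * ln (exp 1 * 4 / \<delta>)} \<in> sets N"
    by measurable
qed

section \<open>The comparator built from random features\<close>

lemma sum_halves:
  fixes f :: "nat \<Rightarrow> real"
  shows "(\<Sum>r<2 * q. f r) = (\<Sum>r<q. f r + f (q + r))"
proof -
  have "(\<Sum>r<2 * q. f r) = (\<Sum>r<q. f r) + (\<Sum>r=q..<q + q. f r)"
    using sum.atLeastLessThan_concat[of 0 q "q + q" f] by (simp add: lessThan_atLeast0 mult_2)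
  also have "(\<Sum>r=q..<q + q. f r) = (\<Sum>r<q. f (q + r))"
    using sum.shift_bounds_nat_ivl[of f 0 q q] by (simp add: lessThan_atLeast0 add.commute)
  finally show ?thesis by (simp add: sum.distrib)
qed

lemma ip_feature_row: "ip p (feature_row p i r G) x = (\<Sum>k<p. G (i, r, k) * x k)"
  by (simp add: ip_def feature_row_def)

lemma net_init_eq_0:
  assumes "even m"
  shows "net \<sigma> p d m b (init_signs m S) (init_theta m G) x i = 0"
proof -
  obtain q where q: "m = 2 * q" using assms by blast
  show ?thesis
    unfolding net_def q by (simp add: sum_halves init_signs_def init_theta_def ip_def)
qed

text \<open>Both rows of a pair use the coefficient at the same Gaussian row, whence the index
  shift. The scale b / m is chosen so that the prefactor 1 / b of the network leaves 1 / m, an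
  average over the rows.\<close>

definition rf_comparator :: "nat \<Rightarrow> nat \<Rightarrow> real \<Rightarrow> (nat \<times> nat \<Rightarrow> real) \<Rightarrow> (nat \<times> nat \<times> nat \<Rightarrow> real)
    \<Rightarrow> (nat \<Rightarrow> (nat \<Rightarrow> real) \<Rightarrow> nat \<Rightarrow> real) \<Rightarrow> params" where
  "rf_comparator p m b S G c = (\<lambda>i r k.
     let w = feature_row p i (if r < m div 2 then r else r - m div 2) G
     in init_theta m G i r k + b / m * init_signs m S i r / p0 p w * c i w k)"

lemma init_signs_abs:
  assumes "even m" "\<And>i r. i < d \<Longrightarrow> r < m div 2 \<Longrightarrow> S (i, r) \<in> {-1, 1}" "i < d" "r < m"
  shows "\<bar>init_signs m S i r\<bar> = 1"
proof (cases "r < m div 2")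
  case True
  then show ?thesis using assms(2)[of i r] assms(3) by (auto simp: init_signs_def)
next
  case False
  then have "r - m div 2 < m div 2" using assms(1,4) by auto
  then show ?thesis using False assms(2)[of i "r - m div 2"] assms(3) by (auto simp: init_signs_def)
qed

text \<open>Each row moves by at most D / sqrt m; m rows and d outputs together give D * sqrt d,
  which is the origin of the radius R.\<close>

lemma frob_rf_comparator_le:
  assumes m: "even m" "0 < m" and b: "b = sqrt (real m)" and D: "0 \<le> D"
    and S: "\<And>i r. i < d \<Longrightarrow> r < m div 2 \<Longrightarrow> S (i, r) \<in> {-1, 1}"
    and cD: "\<And>i w. i < d \<Longrightarrow> vnorm p (c i w) / p0 p w \<le> D"
  shows "frob p d m (rf_comparator p m b S G c) (init_theta m G) \<le> D * sqrt (real d)"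
proof -
  let ?w = "\<lambda>i r. feature_row p i (if r < m div 2 then r else r - m div 2) G"
  have row: "(vnorm p (\<lambda>k. rf_comparator p m b S G c i r k - init_theta m G i r k))\<^sup>2 \<le> D\<^sup>2 / m"
    if ir: "i < d" "r < m" for i r
  proof -
    have "vnorm p (\<lambda>k. rf_comparator p m b S G c i r k - init_theta m G i r k)
        = \<bar>b / m * init_signs m S i r / p0 p (?w i r)\<bar> * vnorm p (c i (?w i r))"
      unfolding vnorm_scale[symmetric] by (simp add: rf_comparator_def Let_def)
    also have "\<dots> = b / m * (vnorm p (c i (?w i r)) / p0 p (?w i r))"
      using init_signs_abs[where S = S and d = d, OF m(1) S ir] b by (simp add: abs_mult)
    also have "\<dots> \<le> b / m * D"
      using cD[OF ir(1)] b by (intro mult_left_mono) auto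
    finally have "(vnorm p (\<lambda>k. rf_comparator p m b S G c i r k - init_theta m G i r k))\<^sup>2 \<le> (b / m * D)\<^sup>2"
      by (intro power_mono) auto
    also have "\<dots> = b\<^sup>2 * D\<^sup>2 / (real m)\<^sup>2" by (simp add: power_mult_distrib power_divide)
    also have "\<dots> = D\<^sup>2 / m" using m(2) by (simp add: b) (simp add: power2_eq_square)
    finally show ?thesis .
  qed
  have "(\<Sum>i<d. \<Sum>r<m. (vnorm p (\<lambda>k. rf_comparator p m b S G c i r k - init_theta m G i r k))\<^sup>2)
      \<le> (\<Sum>i<d. \<Sum>r<m. D\<^sup>2 / m)"
    by (intro sum_mono row) auto
  also have "\<dots> = D\<^sup>2 * d" using m by simp
  finally have "frob p d m (rf_comparator p m b S G c) (init_theta m G) \<le> sqrt (D\<^sup>2 * d)"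
    unfolding frob_def by simp
  then show ?thesis using D by (simp add: real_sqrt_mult)
qed

text \<open>The sign of the displacement meets the output sign and squares to 1, so the two rows of
  a pair contribute equally and the average over m rows is one over the m div 2 sampled
  rows.\<close>

lemma net_lin_rf_comparator:
  assumes m: "even m" "0 < m" and b: "b = sqrt (real m)"
    and S: "\<And>i r. i < d \<Longrightarrow> r < m div 2 \<Longrightarrow> S (i, r) \<in> {-1, 1}" and i: "i < d"
  shows "net_lin \<sigma> p m b (init_signs m S) (init_theta m G) (rf_comparator p m b S G c) x i
    = (1 / real (m div 2)) * (\<Sum>r<m div 2. rf_sample \<sigma> p (c i) x (feature_row p i r G))"
proof -
  obtain q where q: "m = 2 * q" using m(1) by blast
  have q0: "0 < q" using m(2) q by simp
  have b0: "0 < b" using m(2) b by simp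
  let ?w = "\<lambda>r. feature_row p i (if r < q then r else r - q) G"
  have summand: "init_signs m S i r * deriv \<sigma> (ip p (init_theta m G i r) x)
      * ip p (\<lambda>k. rf_comparator p m b S G c i r k - init_theta m G i r k) x
      = b / m * rf_sample \<sigma> p (c i) x (?w r)" if r: "r < m" for r
  proof -
    have "ip p (init_theta m G i r) x = ip p (?w r) x"
      unfolding ip_feature_row by (simp add: ip_def init_theta_def q)
    moreover have "ip p (\<lambda>k. rf_comparator p m b S G c i r k - init_theta m G i r k) x
        = b / m * init_signs m S i r / p0 p (?w r) * ip p (c i (?w r)) x"
      by (simp add: rf_comparator_def Let_def ip_def sum_distrib_left mult.assoc q)
    moreover have "init_signs m S i r * init_signs m S i r = 1"
      using init_signs_abs[where S = S and d = d, OF m(1) S i r] by (metis abs_mult_self_eq mult_1)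
    ultimately show ?thesis by (simp add: rf_sample_def)
  qed
  have "net_lin \<sigma> p m b (init_signs m S) (init_theta m G) (rf_comparator p m b S G c) x i
      = (1 / b) * (\<Sum>r<m. b / m * rf_sample \<sigma> p (c i) x (?w r))"
    unfolding net_lin_def by (intro arg_cong2[where f = "(*)"] sum.cong refl summand) auto
  also have "\<dots> = (1 / m) * (\<Sum>r<2 * q. rf_sample \<sigma> p (c i) x (?w r))"
    unfolding sum_distrib_left[symmetric] using b0 by (simp add: q)
  also have "(\<Sum>r<2 * q. rf_sample \<sigma> p (c i) x (?w r)) = 2 * (\<Sum>r<q. rf_sample \<sigma> p (c i) x (feature_row p i r G))"
    by (simp add: sum_halves sum_distrib_left)
  finally show ?thesis using q0 by (simp add: q)
qed

text \<open>Cauchy-Schwarz over the rounds, normalised so that the average over all d * T errors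
  appears, the quantity whose tail is controlled.\<close>

lemma sum_vnorm_le_rms:
  "(\<Sum>t=1..T. vnorm d (e t)) \<le> real T * sqrt (real d) * sqrt ((1 / real (d * T)) * (\<Sum>i<d. \<Sum>t=1..T. (e t i)\<^sup>2))"
proof (cases "d * T = 0")
  case True
  then show ?thesis by (auto simp: vnorm_def)
next
  case False
  then have dT: "0 < real d" "0 < real T" by auto
  have "(\<Sum>t=1..T. vnorm d (e t)) = (\<Sum>t=1..T. \<bar>1\<bar> * \<bar>vnorm d (e t)\<bar>)" by simp
  also have "\<dots> \<le> L2_set (\<lambda>_. 1) {1..T} * L2_set (\<lambda>t. vnorm d (e t)) {1..T}"
    by (rule L2_set_mult_ineq)
  also have "\<dots> = sqrt T * sqrt (\<Sum>i<d. \<Sum>t=1..T. (e t i)\<^sup>2)"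
    unfolding L2_set_def power2_vnorm by (subst sum.swap) simp
  also have "\<dots> = real T * sqrt (real d) * sqrt ((1 / real (d * T)) * (\<Sum>i<d. \<Sum>t=1..T. (e t i)\<^sup>2))"
    using dT by (simp add: real_sqrt_mult real_sqrt_divide field_simps)
  finally show ?thesis .
qed

text \<open>The deterministic half of the argument, valid for every draw whose signs are 1 or -1.
  The factor 5 is 4 from linearising at the iterates plus 1 from linearising the comparator at the
  initialization, which is at distance at most R.\<close>

lemma ogd_random_feature_regret:
  assumes diff: "\<And>z. \<sigma> differentiable (at z)"
    and lip: "\<And>z z'. \<bar>deriv \<sigma> z - deriv \<sigma> z'\<bar> \<le> C * \<bar>z - z'\<bar>"
    and bound: "\<And>z. \<bar>deriv \<sigma> z\<bar> \<le> C" and C: "0 < C" and L: "0 < L" and D: "0 < D"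
    and d: "0 < d" and m: "even m" "0 < m" and b: "b = sqrt (real m)" and R: "R = D * sqrt (real d)"
    and x: "\<And>t. t \<in> {1..T} \<Longrightarrow> vnorm p (x t) = 1"
    and cvx: "\<And>t. t \<in> {1..T} \<Longrightarrow> convex_vec d (ell t)"
    and dif: "\<And>t. t \<in> {1..T} \<Longrightarrow> differentiable_vec d (ell t)"
    and lipl: "\<And>t. t \<in> {1..T} \<Longrightarrow> lipschitz_vec d L (ell t)"
    and S: "\<And>i r. i < d \<Longrightarrow> r < m div 2 \<Longrightarrow> S (i, r) \<in> {-1, 1}"
    and cD: "\<And>i w. i < d \<Longrightarrow> vnorm p (c i w) / p0 p w \<le> D"
    and y: "\<And>t. t \<in> {1..T} \<Longrightarrow> y t \<in> vspace d"
    and \<eta>: "\<eta> = (\<lambda>t::nat. 2 * R / (C * L) * (real t) powr (-1/2))"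
    and err: "err = (\<lambda>i t. (1 / real (m div 2)) * (\<Sum>r<m div 2. rf_sample \<sigma> p (c i) (x t) (feature_row p i r G)) - y t i)"
  shows "(\<Sum>t=1..T. ell t (net \<sigma> p d m b (init_signs m S)
      (ogd \<sigma> p d m b (init_signs m S) (init_theta m G) R \<eta> ell x (t - 1)) (x t)))
    \<le> (\<Sum>t=1..T. ell t (y t)) + 3 * (C * L * D * sqrt (real d * real T))
      + 5 * (C * L * D\<^sup>2 * real d * real T / sqrt (real m))
      + L * (real T * sqrt (real d) * sqrt ((1 / real (d * T)) * (\<Sum>i<d. \<Sum>t=1..T. (err i t)\<^sup>2)))"
proof -
  let ?a = "init_signs m S" and ?\<theta>1 = "init_theta m G"
  define \<theta>s where "\<theta>s = rf_comparator p m b S G c"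
  have b0: "0 < b" using m b by simp
  have R0: "0 < R" using D d by (simp add: R)
  have a: "\<bar>?a i r\<bar> = 1" if "i < d" "r < m" for i r
    using init_signs_abs[where S = S and d = d, OF m(1) S that] .
  have \<theta>s: "frob p d m \<theta>s ?\<theta>1 \<le> R"
    unfolding \<theta>s_def R by (rule frob_rf_comparator_le[OF m b]) (use D S cD in auto)
  have approx: "vnorm d (\<lambda>i. net \<sigma> p d m b ?a \<theta>s (x t) i - y t i) \<le> C / b * R\<^sup>2 + vnorm d (\<lambda>i. err i t)"
    if t: "t \<in> {1..T}" for t
  proof -
    let ?lin = "net_lin \<sigma> p m b ?a ?\<theta>1 \<theta>s (x t)"
    let ?rem = "\<lambda>i. net \<sigma> p d m b ?a \<theta>s (x t) i - net \<sigma> p d m b ?a ?\<theta>1 (x t) i - ?lin i"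
    have lin: "?lin i - y t i = err i t" if "i < d" for i
      using net_lin_rf_comparator[where S = S and d = d, OF m b S that, of \<sigma> p G c "x t"]
      by (simp add: \<theta>s_def err)
    have "vnorm d (\<lambda>i. net \<sigma> p d m b ?a \<theta>s (x t) i - y t i) = vnorm d (\<lambda>i. ?rem i + (?lin i - y t i))"
      by (simp add: net_init_eq_0[OF m(1)])
    also have "\<dots> \<le> vnorm d ?rem + vnorm d (\<lambda>i. ?lin i - y t i)"
      by (rule vnorm_triangle)
    also have "vnorm d (\<lambda>i. ?lin i - y t i) = vnorm d (\<lambda>i. err i t)"
      unfolding vnorm_def by (simp add: lin)
    also have "vnorm d ?rem \<le> (\<Sum>i<d. \<bar>?rem i\<bar>)" by (rule vnorm_le_sum)
    also have "\<dots> \<le> C / b * (frob p d m \<theta>s ?\<theta>1)\<^sup>2"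
      using net_linearization_error[OF diff lip b0 a x[OF t]] .
    also have "\<dots> \<le> C / b * R\<^sup>2"
      using C b0 \<theta>s by (intro mult_left_mono power_mono) auto
    finally show ?thesis by simp
  qed
  have "(\<Sum>t=1..T. vnorm d (\<lambda>i. net \<sigma> p d m b ?a \<theta>s (x t) i - y t i))
      \<le> (\<Sum>t=1..T. C / b * R\<^sup>2 + vnorm d (\<lambda>i. err i t))"
    by (intro sum_mono approx)
  also have "\<dots> = T * (C / b * R\<^sup>2) + (\<Sum>t=1..T. vnorm d (\<lambda>i. err i t))"
    by (simp add: sum.distrib)
  also have "\<dots> \<le> T * (C / b * R\<^sup>2)
      + real T * sqrt (real d) * sqrt ((1 / real (d * T)) * (\<Sum>i<d. \<Sum>t=1..T. (err i t)\<^sup>2))"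
    using sum_vnorm_le_rms[of d "\<lambda>t i. err i t" T] by simp
  finally have "L * (\<Sum>t=1..T. vnorm d (\<lambda>i. net \<sigma> p d m b ?a \<theta>s (x t) i - y t i))
      \<le> L * (T * (C / b * R\<^sup>2)
      + real T * sqrt (real d) * sqrt ((1 / real (d * T)) * (\<Sum>i<d. \<Sum>t=1..T. (err i t)\<^sup>2)))"
    using L by (intro mult_left_mono) auto
  moreover have "3 * R * (C * L) * sqrt T = 3 * (C * L * D * sqrt (real d * real T))"
    by (simp add: R real_sqrt_mult)
  moreover have "T * (L * (4 * C * R\<^sup>2 / b)) + L * (T * (C / b * R\<^sup>2)) = 5 * (C * L * D\<^sup>2 * real d * real T / sqrt (real m))"
    using b0 by (simp add: R power_mult_distrib b[symmetric] field_simps)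
  moreover have "(\<Sum>t=1..T. ell t (net \<sigma> p d m b ?a (ogd \<sigma> p d m b ?a ?\<theta>1 R \<eta> ell x (t - 1)) (x t)))
    \<le> (\<Sum>t=1..T. ell t (y t)) + 3 * R * (C * L) * sqrt T + T * (L * (4 * C * R\<^sup>2 / b))
      + L * (\<Sum>t=1..T. vnorm d (\<lambda>i. net \<sigma> p d m b ?a \<theta>s (x t) i - y t i))"
    by (rule ogd_regret) fact+
  ultimately show ?thesis unfolding distrib_left[of L] by linarith
qed

section \<open>The infimum over the random feature class\<close>

lemma RF_spaceE:
  assumes "h \<in> RF_space \<sigma> p D"
  obtains c where "\<And>k. k < p \<Longrightarrow> (\<lambda>w. c w k) \<in> borel_measurable (lebesgue_Rp p)"
    "\<And>w. vnorm p (c w) / p0 p w \<le> D"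
    "\<And>x. h x = (LINT w|lebesgue_Rp p. ip p (c w) x * deriv \<sigma> (ip p w x))"
  using assms unfolding RF_space_def by auto

text \<open>A random feature function is a Gaussian mean of samples bounded by C * D.\<close>

lemma abs_RF_space_le:
  assumes h: "h \<in> RF_space \<sigma> p D" and \<sigma>: "deriv \<sigma> \<in> borel_measurable borel" "\<And>z. \<bar>deriv \<sigma> z\<bar> \<le> C"
    and x: "vnorm p x = 1"
  shows "\<bar>h x\<bar> \<le> C * D"
proof -
  interpret prob_space "gauss p" by (rule prob_space_gauss)
  obtain c where c: "\<And>k. k < p \<Longrightarrow> (\<lambda>w. c w k) \<in> borel_measurable (lebesgue_Rp p)"
    "\<And>w. vnorm p (c w) / p0 p w \<le> D"
    "\<And>x. h x = (LINT w|lebesgue_Rp p. ip p (c w) x * deriv \<sigma> (ip p w x))"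
    using RF_spaceE[OF h] by blast
  have le: "\<bar>rf_sample \<sigma> p c x w\<bar> \<le> C * D" for w
    by (rule abs_rf_sample_le[OF c(2) \<sigma>(2) x])
  have int: "integrable (gauss p) (rf_sample \<sigma> p c x)"
    by (rule integrable_const_bound[of _ "C * D"]) (use le rf_sample_measurable[OF c(1) \<sigma>(1)] in auto)
  have "\<bar>h x\<bar> = \<bar>LINT w|gauss p. rf_sample \<sigma> p c x w\<bar>"
    by (simp add: c(3) integral_rf_sample[OF c(1) \<sigma>(1)])
  also have "\<dots> \<le> (LINT w|gauss p. \<bar>rf_sample \<sigma> p c x w\<bar>)"
    by (rule integral_abs_bound)
  also have "\<dots> \<le> (LINT w|gauss p. C * D)"
    by (intro integral_mono) (use int le in auto)
  also have "\<dots> = C * D" by (simp add: prob_space)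
  finally show ?thesis .
qed

lemma zero_in_RF_space_vec: "0 \<le> D \<Longrightarrow> (\<lambda>_ _. 0) \<in> RF_space_vec \<sigma> p d D"
  unfolding RF_space_vec_def RF_space_def
  by (auto intro!: exI[of _ "\<lambda>_ _. 0"] simp: vnorm_def ip_def)

lemma RF_space_vec_in_vspace: "g \<in> RF_space_vec \<sigma> p d D \<Longrightarrow> g x \<in> vspace d"
  by (simp add: RF_space_vec_def vspace_def)

text \<open>Without a lower bound \<open>Inf\<close> would carry no information. The Lipschitz
  condition compares every g with the zero vector, round by round.\<close>

lemma bdd_below_RF_loss:
  assumes \<sigma>: "deriv \<sigma> \<in> borel_measurable borel" "\<And>z. \<bar>deriv \<sigma> z\<bar> \<le> C" and L: "0 \<le> L" and CD: "0 \<le> C * D"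
    and x: "\<And>t. t \<in> {1..T} \<Longrightarrow> vnorm p (x t) = 1"
    and lip: "\<And>t. t \<in> {1..T} \<Longrightarrow> lipschitz_vec d L (ell t)"
  shows "bdd_below ((\<lambda>g. \<Sum>t=1..T. ell t (g (x t))) ` RF_space_vec \<sigma> p d D)"
proof (rule bdd_belowI2[where m = "\<Sum>t=1..T. ell t (\<lambda>_. 0) - L * (sqrt d * (C * D))"])
  fix g assume g: "g \<in> RF_space_vec \<sigma> p d D"
  show "(\<Sum>t=1..T. ell t (\<lambda>_. 0) - L * (sqrt d * (C * D))) \<le> (\<Sum>t=1..T. ell t (g (x t)))"
  proof (intro sum_mono)
    fix t assume t: "t \<in> {1..T}"
    have "(\<lambda>_. 0) \<in> vspace d" by (simp add: vspace_def)
    then have "\<bar>ell t (g (x t)) - ell t (\<lambda>_. 0)\<bar> \<le> L * vnorm d (\<lambda>k. g (x t) k - 0)"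
      using lip[OF t] RF_space_vec_in_vspace[OF g, of "x t"] unfolding lipschitz_vec_def by blast
    also have "\<dots> \<le> L * (sqrt d * (C * D))"
      using g CD L by (intro mult_left_mono vnorm_le_of_components)
        (auto simp: RF_space_vec_def intro!: abs_RF_space_le[OF _ \<sigma> x[OF t]])
    finally show "ell t (\<lambda>_. 0) - L * (sqrt d * (C * D)) \<le> ell t (g (x t))" by linarith
  qed
qed

section \<open>The random initialization and its measurability\<close>

lemma prob_space_init_measure: "prob_space (init_measure p d m)"
proof -
  interpret A: prob_space "PiM ({..<d} \<times> {..<m div 2}) (\<lambda>_. measure_pmf (pmf_of_set {-1, 1::real}))"
    by (intro prob_space_PiM) (rule measure_pmf.prob_space_axioms)
  interpret B: prob_space "PiM ({..<d} \<times> {..<m div 2} \<times> {..<p}) (\<lambda>_. std_normal_distribution)"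
    by (rule prob_space_gauss)
  interpret pair_prob_space "PiM ({..<d} \<times> {..<m div 2}) (\<lambda>_. measure_pmf (pmf_of_set {-1, 1::real}))"
    "PiM ({..<d} \<times> {..<m div 2} \<times> {..<p}) (\<lambda>_. std_normal_distribution)" ..
  show ?thesis unfolding init_measure_def by (rule prob_space_axioms)
qed

text \<open>The signs are arbitrary reals on the sample space and lie in \<open>{-1, 1}\<close> only almost surely.\<close>

lemma measure_init_good_event:
  fixes E :: "(nat \<times> nat \<times> nat \<Rightarrow> real) set"
  assumes E: "E \<in> sets (PiM ({..<d} \<times> {..<m div 2} \<times> {..<p}) (\<lambda>_. std_normal_distribution))"
    and A: "A \<in> sets (init_measure p d m)"
    and sub: "\<And>S G. (S, G) \<in> space (init_measure p d m) \<Longrightarrow> G \<in> E \<Longrightarrow>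
      (\<And>i r. i < d \<Longrightarrow> r < m div 2 \<Longrightarrow> S (i, r) \<in> {-1, 1}) \<Longrightarrow> (S, G) \<in> A"
  shows "measure (PiM ({..<d} \<times> {..<m div 2} \<times> {..<p}) (\<lambda>_. std_normal_distribution)) E
    \<le> measure (init_measure p d m) A"
proof -
  define M1 where "M1 = PiM ({..<d} \<times> {..<m div 2}) (\<lambda>_. measure_pmf (pmf_of_set {-1, 1::real}))"
  define M2 where "M2 = PiM ({..<d} \<times> {..<m div 2} \<times> {..<p}) (\<lambda>_. std_normal_distribution)"
  have M: "init_measure p d m = M1 \<Otimes>\<^sub>M M2" by (simp add: init_measure_def M1_def M2_def)
  interpret A: prob_space M1 unfolding M1_def
    by (intro prob_space_PiM) (rule measure_pmf.prob_space_axioms)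
  interpret B: prob_space M2 unfolding M2_def by (rule prob_space_gauss)
  interpret I: prob_space "M1 \<Otimes>\<^sub>M M2" using prob_space_init_measure[of p d m] by (simp add: M)
  \<comment> \<open>A set of full measure, so restricting to it loses no probability and all of
    \<delta> can be spent on the Gaussian rows.\<close>
  define S1 where "S1 = {S \<in> space M1. \<forall>j\<in>{..<d} \<times> {..<m div 2}. S j \<in> {-1, 1}}"
  have comp: "(\<lambda>S. S j) \<in> borel_measurable M1" if "j \<in> {..<d} \<times> {..<m div 2}" for j
    unfolding M1_def by (rule measurable_compose[OF measurable_component_singleton[OF that]]) simp
  have S1: "S1 \<in> sets M1" unfolding S1_def using comp by measurable
  have "AE S in M1. S j \<in> {-1, 1}" if "j \<in> {..<d} \<times> {..<m div 2}" for j
    unfolding M1_def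
    by (rule AE_PiM_component[OF _ that]) (auto simp: measure_pmf.prob_space_axioms AE_measure_pmf_iff)
  then have "AE S in M1. \<forall>j\<in>{..<d} \<times> {..<m div 2}. S j \<in> {-1, 1}"
    by (intro AE_finite_allI) auto
  then have "A.prob S1 = 1" unfolding S1_def using S1
    by (subst A.prob_Collect_eq_1) (auto simp: S1_def)
  then have "emeasure M1 S1 = 1" by (simp add: A.emeasure_eq_measure)
  then have "emeasure (M1 \<Otimes>\<^sub>M M2) (S1 \<times> E) = emeasure M2 E"
    using B.emeasure_pair_measure_Times[OF S1] E by (simp add: M2_def)
  then have "measure M2 E = I.prob (S1 \<times> E)"
    by (simp add: measure_def)
  also have "\<dots> \<le> I.prob A"
  proof (rule I.finite_measure_mono)
    show "A \<in> sets (M1 \<Otimes>\<^sub>M M2)" using A by (simp add: M)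
    show "S1 \<times> E \<subseteq> A"
    proof
      fix z assume "z \<in> S1 \<times> E"
      then obtain S G where z: "z = (S, G)" "S \<in> S1" "G \<in> E" by blast
      have "G \<in> space M2" using sets.sets_into_space[OF E] z by (auto simp: M2_def)
      then have "(S, G) \<in> space (init_measure p d m)" using z by (simp add: M S1_def space_pair_measure)
      then show "z \<in> A" unfolding z(1) using z by (intro sub) (auto simp: S1_def)
    qed
  qed
  finally show ?thesis by (simp add: M M2_def)
qed

lemma borel_measurable_init_theta:
  assumes "even m" "i < d" "r < m" "k < p"
  shows "(\<lambda>\<omega>. init_theta m (snd \<omega>) i r k) \<in> borel_measurable (init_measure p d m)"
proof -
  let ?I = "{..<d} \<times> {..<m div 2} \<times> {..<p}"
  have *: "(\<lambda>\<omega>. snd \<omega> j) \<in> borel_measurable (init_measure p d m)" if "j \<in> ?I" for j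
  proof -
    have "(\<lambda>G. G j) \<in> borel_measurable (PiM ?I (\<lambda>_. std_normal_distribution))"
      using measurable_component_singleton[OF that, of "\<lambda>_. std_normal_distribution"] by simp
    from measurable_compose[OF measurable_snd this] show ?thesis by (simp add: init_measure_def)
  qed
  have "r - m div 2 < m div 2" if "\<not> r < m div 2" using that assms by auto
  then show ?thesis using assms *[of "(i, r, k)"] *[of "(i, r - m div 2, k)"]
    by (cases "r < m div 2") (simp_all add: init_theta_def)
qed

lemma borel_measurable_init_signs:
  assumes "even m" "i < d" "r < m"
  shows "(\<lambda>\<omega>. init_signs m (fst \<omega>) i r) \<in> borel_measurable (init_measure p d m)"
proof -
  let ?I = "{..<d} \<times> {..<m div 2}"
  have *: "(\<lambda>\<omega>. fst \<omega> j) \<in> borel_measurable (init_measure p d m)" if "j \<in> ?I" for j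
  proof -
    have "(\<lambda>S. S j) \<in> borel_measurable (PiM ?I (\<lambda>_. measure_pmf (pmf_of_set {-1, 1::real})))"
      by (rule measurable_compose[OF measurable_component_singleton[OF that]]) simp
    from measurable_compose[OF measurable_fst this] show ?thesis by (simp add: init_measure_def)
  qed
  have "r - m div 2 < m div 2" if "\<not> r < m div 2" using that assms by auto
  then show ?thesis using assms *[of "(i, r)"] *[of "(i, r - m div 2)"]
    by (cases "r < m div 2") (simp_all add: init_signs_def)
qed

text \<open>Absorbs the constants: 1 + ln 4 \<le> 3, and ln d \<ge> 0 lets ln (d / \<delta>) take
  the place of ln (1 / \<delta>).\<close>

lemma ln_rf_tail_le:
  assumes "0 < \<delta>" "\<delta> < 1" "1 \<le> (d::nat)"
  shows "ln (exp 1 * 4 / \<delta>) \<le> 3 * (1 + ln (real d / \<delta>))"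
proof -
  have "ln (4::real) = 2 * ln 2" using ln_realpow[of "2::real" 2] by simp
  then have "ln (4::real) \<le> 2" using ln_2_less_1 by simp
  moreover have eq: "ln (exp 1 * 4 / \<delta>) = 1 + ln 4 - ln \<delta>" "ln (real d / \<delta>) = ln (real d) - ln \<delta>"
    using assms by (simp_all add: ln_div ln_mult)
  moreover have "0 \<le> ln (real d)" "ln \<delta> < 0" using assms by auto
  ultimately show ?thesis unfolding eq by (simp add: algebra_simps)
qed

theorem mainTheorem7:
  shows "\<exists>K>0. \<forall>(\<sigma>::real \<Rightarrow> real) (C::real) (p::nat) (d::nat) (m::nat) (\<delta>::real) (D::real) (L::real)
      (T::nat) (x::nat \<Rightarrow> nat \<Rightarrow> real) (ell::nat \<Rightarrow> (nat \<Rightarrow> real) \<Rightarrow> real).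
    1 \<le> p \<and> 1 \<le> d \<and> 0 < m \<and> even m \<and> 0 < C \<and>
    (\<forall>z. \<sigma> differentiable (at z)) \<and>
    (\<forall>z z'. \<bar>deriv \<sigma> z - deriv \<sigma> z'\<bar> \<le> C * \<bar>z - z'\<bar>) \<and>
    (\<forall>z. \<bar>deriv \<sigma> z\<bar> \<le> C) \<and>
    0 < \<delta> \<and> \<delta> < 1 \<and> 1 < D \<and> 0 < L \<and>
    (\<forall>t\<in>{1..T}. vnorm p (x t) = 1 \<and> convex_vec d (ell t) \<and> differentiable_vec d (ell t)
                 \<and> lipschitz_vec d L (ell t))
    \<longrightarrow>
    (let b = sqrt (real m); R = D * sqrt (real d);
         \<eta> = (\<lambda>t::nat. 2 * R / (C * L) * (real t) powr (-1/2))
     in measure (init_measure p d m)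
          {\<omega> \<in> space (init_measure p d m).
             \<forall>g\<in>RF_space_vec \<sigma> p d D.
               (\<Sum>t=1..T. ell t (net \<sigma> p d m b (init_signs m (fst \<omega>))
                   (ogd \<sigma> p d m b (init_signs m (fst \<omega>)) (init_theta m (snd \<omega>)) R \<eta> ell x (t - 1)) (x t)))
               \<le> (\<Sum>t=1..T. ell t (g (x t)))
                 + K * (1 + ln (real d / \<delta>)) ^ nat \<lceil>K\<rceil> * L * sqrt (real d * real p) * C * D\<^sup>2 * real T / sqrt (real m)
                 + K * (C * L * D * sqrt (real d * real T) + C * L * D\<^sup>2 * real d * real T / sqrt (real m))}
        \<ge> 1 - \<delta>)"
\<comment> \<open>5 must serve as the factor of both error terms and, through the ceiling, as the
  power of the logarithm. The factors that arise are 3 * sqrt 2, 3 + 1 and 5, with one power of the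
  logarithm.\<close>
proof (intro exI[of _ 5] conjI allI impI, simp, elim conjE)
  fix \<sigma> :: "real \<Rightarrow> real" and C :: real and p d m :: nat and \<delta> D L :: real and T :: nat
    and x :: "nat \<Rightarrow> nat \<Rightarrow> real" and ell :: "nat \<Rightarrow> (nat \<Rightarrow> real) \<Rightarrow> real"
  assume p: "1 \<le> p" and d: "1 \<le> d" and m: "0 < m" "even m" and C: "0 < C"
    and diff': "\<forall>z. \<sigma> differentiable (at z)"
    and lip': "\<forall>z z'. \<bar>deriv \<sigma> z - deriv \<sigma> z'\<bar> \<le> C * \<bar>z - z'\<bar>"
    and bound': "\<forall>z. \<bar>deriv \<sigma> z\<bar> \<le> C"
    and \<delta>: "0 < \<delta>" "\<delta> < 1" and D: "1 < D" and L: "0 < L"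
    and rounds: "\<forall>t\<in>{1..T}. vnorm p (x t) = 1 \<and> convex_vec d (ell t) \<and> differentiable_vec d (ell t)
                 \<and> lipschitz_vec d L (ell t)"
  note diff = diff'[rule_format] and lip = lip'[rule_format] and bound = bound'[rule_format]
  have x: "vnorm p (x t) = 1" and cvx: "convex_vec d (ell t)"
    and dif: "differentiable_vec d (ell t)" and lipl: "lipschitz_vec d L (ell t)" if "t \<in> {1..T}" for t
    using rounds that by auto
  define b where "b = sqrt (real m)"
  define R where "R = D * sqrt (real d)"
  define \<eta> where "\<eta> = (\<lambda>t::nat. 2 * R / (C * L) * (real t) powr (-1/2))"
  define loss where "loss = (\<lambda>\<omega>. \<Sum>t=1..T. ell t (net \<sigma> p d m b (init_signs m (fst \<omega>))
      (ogd \<sigma> p d m b (init_signs m (fst \<omega>)) (init_theta m (snd \<omega>)) R \<eta> ell x (t - 1)) (x t)))"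
  define val where "val = (\<lambda>g. \<Sum>t=1..T. ell t (g (x t)))"
  define X1 where "X1 = L * sqrt (real d * real p) * C * D\<^sup>2 * real T / sqrt (real m)"
  define X2 where "X2 = C * L * D * sqrt (real d * real T)"
  define X3 where "X3 = C * L * D\<^sup>2 * real d * real T / sqrt (real m)"
  define l where "l = 1 + ln (real d / \<delta>)"
  define rest where "rest = 5 * l ^ 5 * X1 + 5 * (X2 + X3)"
  let ?M = "init_measure p d m" and ?RF = "RF_space_vec \<sigma> p d D"
  interpret prob_space ?M by (rule prob_space_init_measure)
  define A where "A = {\<omega> \<in> space ?M. \<forall>g\<in>?RF. loss \<omega> \<le> val g + rest}"
  have \<sigma>': "deriv \<sigma> \<in> borel_measurable borel"
  proof (rule borel_measurable_continuous_onI)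
    have "C-lipschitz_on UNIV (deriv \<sigma>)"
      by (rule lipschitz_onI) (use lip C in \<open>auto simp: dist_real_def\<close>)
    then show "continuous_on UNIV (deriv \<sigma>)" by (rule lipschitz_on_continuous_on)
  qed
  have \<sigma>: "\<sigma> \<in> borel_measurable borel"
    by (intro borel_measurable_continuous_onI continuous_at_imp_continuous_on ballI
        differentiable_imp_continuous_within diff)
  have l: "1 \<le> l"
    using \<delta> d by (simp add: l_def)
  have X: "0 \<le> X1" "0 \<le> X2" "0 \<le> X3"
    using C L D by (simp_all add: X1_def X2_def X3_def)
  have RF0: "?RF \<noteq> {}" using zero_in_RF_space_vec[of D \<sigma> p d] D by auto
  have bdd: "bdd_below (val ` ?RF)"
    unfolding val_def by (rule bdd_below_RF_loss[OF \<sigma>' bound _ _ x lipl]) (use L C D in auto)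
  \<comment> \<open>The intersection over the uncountable class becomes a single inequality with an
    infimum, which makes the event measurable.\<close>
  have A_Inf: "A = {\<omega> \<in> space ?M. loss \<omega> \<le> Inf (val ` ?RF) + rest}"
  proof -
    have "(\<forall>g\<in>?RF. loss \<omega> \<le> val g + rest) \<longleftrightarrow> loss \<omega> - rest \<le> Inf (val ` ?RF)" for \<omega>
      using le_cINF_iff[OF RF0 bdd, of "loss \<omega> - rest"] by (simp add: algebra_simps)
    then show ?thesis unfolding A_def by (auto simp: algebra_simps)
  qed
  have [measurable]: "loss \<in> borel_measurable ?M"
    unfolding loss_def
  proof (intro borel_measurable_sum borel_measurable_lipschitz_vec[OF lipl] net_in_vspace)
    fix t k assume t: "t \<in> {1..T}" and k: "k < d"
    show "(\<lambda>\<omega>. net \<sigma> p d m b (init_signs m (fst \<omega>))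
        (ogd \<sigma> p d m b (init_signs m (fst \<omega>)) (init_theta m (snd \<omega>)) R \<eta> ell x (t - 1)) (x t) k)
      \<in> borel_measurable ?M"
    proof (rule borel_measurable_net[OF \<sigma> _ _ k])
      fix i r j assume "i < d" "r < m" "j < p"
      then show "(\<lambda>\<omega>. ogd \<sigma> p d m b (init_signs m (fst \<omega>)) (init_theta m (snd \<omega>)) R \<eta> ell x (t - 1) i r j)
          \<in> borel_measurable ?M"
        using t by (intro borel_measurable_ogd[where T = T and L = L] \<sigma> \<sigma>' dif lipl
            borel_measurable_init_signs borel_measurable_init_theta m) auto
    qed (intro borel_measurable_init_signs m)
  qed
  have A_sets: "A \<in> sets ?M" unfolding A_Inf by measurable
  have main: "1 - \<delta> \<le> prob A"
  \<comment> \<open>For T = 0 the slack X2 vanishes and leaves no room for a near-minimiser; but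
    then all losses are empty sums.\<close>
  proof (cases "T = 0")
    case True
    then have "A = space ?M"
      using X l by (auto simp: A_def loss_def val_def rest_def)
    then show ?thesis using \<delta> by (simp add: prob_space)
  next
    case False
    then have T: "0 < T" by simp
    have "0 < X2" using C L D d T by (simp add: X2_def)
    then have "Inf (val ` ?RF) < Inf (val ` ?RF) + X2" by simp
    \<comment> \<open>Chosen before the draw, so its coefficients do not depend on the sample. The
      excess raises the factor of X2 from 3 to 4.\<close>
    then obtain g where g: "g \<in> ?RF" and gX: "val g < Inf (val ` ?RF) + X2"
      unfolding cINF_less_iff[OF RF0 bdd] by blast
    have "\<exists>c. (\<forall>k<p. (\<lambda>w. c w k) \<in> borel_measurable (lebesgue_Rp p)) \<and>
        (\<forall>w. vnorm p (c w) / p0 p w \<le> D) \<and>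
        (\<forall>x. g x i = (LINT w | lebesgue_Rp p. ip p (c w) x * deriv \<sigma> (ip p w x)))"
      (is "\<exists>c. ?P i c") if "i < d" for i
      using g that unfolding RF_space_vec_def RF_space_def by blast
    then have "\<forall>i\<in>{..<d}. \<exists>c. ?P i c" by blast
    then obtain c where "\<forall>i\<in>{..<d}. ?P i (c i)" by (rule bchoice[THEN exE])
    then have c: "\<And>i k. i < d \<Longrightarrow> k < p \<Longrightarrow> (\<lambda>w. c i w k) \<in> borel_measurable (lebesgue_Rp p)"
        "\<And>i w. i < d \<Longrightarrow> vnorm p (c i w) / p0 p w \<le> D"
        "\<And>i x. i < d \<Longrightarrow> g x i = (LINT w | lebesgue_Rp p. ip p (c i w) x * deriv \<sigma> (ip p w x))"
      by auto
    define N where "N = PiM ({..<d} \<times> {..<m div 2} \<times> {..<p}) (\<lambda>_. std_normal_distribution)"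
    define err where "err = (\<lambda>i t G. (1 / real (m div 2)) * (\<Sum>r<m div 2. rf_sample \<sigma> p (c i) (x t) (feature_row p i r G)) - g (x t) i)"
    define E where "E = {G \<in> space N. sqrt ((1 / real (d * T)) * (\<Sum>i<d. \<Sum>t=1..T. (err i t G)\<^sup>2))
        \<le> C * D / sqrt (real (m div 2)) * ln (exp 1 * 4 / \<delta>)}"
    have pos: "0 < d" "0 < m div 2" "0 < p" "0 < D" using p d m D by auto
    have h: "g (x t) i = (LINT w|lebesgue_Rp p. ip p (c i w) (x t) * deriv \<sigma> (ip p w (x t)))"
      if "i < d" "t \<in> {1..T}" for i t using c(3) that by simp
    have E: "E \<in> sets N" "1 - \<delta> \<le> measure N E"
      unfolding E_def by (rule rf_rms_concentration[where h = "\<lambda>i t. g (x t) i"]; fact)+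
    have "measure N E \<le> prob A"
      unfolding N_def
    proof (rule measure_init_good_event[OF E(1)[unfolded N_def] A_sets])
      fix S G assume SG: "(S, G) \<in> space ?M" and G: "G \<in> E"
        and S: "\<And>i r. i < d \<Longrightarrow> r < m div 2 \<Longrightarrow> S (i, r) \<in> {-1, 1}"
      let ?rms = "sqrt ((1 / real (d * T)) * (\<Sum>i<d. \<Sum>t=1..T. (err i t G)\<^sup>2))"
      have "loss (S, G) \<le> val g + 3 * X2 + 5 * X3 + L * (real T * sqrt (real d) * ?rms)"
        unfolding loss_def val_def X2_def X3_def fst_conv snd_conv
      proof (rule ogd_random_feature_regret)
        show "g (x t) \<in> vspace d" for t by (rule RF_space_vec_in_vspace[OF g])
        show "(\<lambda>i t. err i t G) = (\<lambda>i t. (1 / real (m div 2)) *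
            (\<Sum>r<m div 2. rf_sample \<sigma> p (c i) (x t) (feature_row p i r G)) - g (x t) i)"
          by (simp add: err_def)
      qed fact+
      moreover have "L * (real T * sqrt (real d) * ?rms) \<le> 5 * l ^ 5 * X1"
      proof -
        have "?rms \<le> C * D / sqrt (real (m div 2)) * ln (exp 1 * 4 / \<delta>)" using G by (simp add: E_def)
        also have "\<dots> \<le> C * D / sqrt (real (m div 2)) * (3 * l)"
          using C D ln_rf_tail_le[OF \<delta> d] by (intro mult_left_mono) (auto simp: l_def)
        \<comment> \<open>Only m div 2 rows are sampled independently, which is where sqrt 2 comes
          from.\<close>
        also have "\<dots> = sqrt 2 * 3 * l * (C * D / sqrt (real m))"
          using m by (simp add: real_of_nat_div real_sqrt_divide)
        finally have "L * (real T * sqrt (real d) * ?rms)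
            \<le> L * (real T * sqrt (real d) * (sqrt 2 * 3 * l * (C * D / sqrt (real m))))"
          using L by (intro mult_left_mono) auto
        also have "\<dots> = (sqrt 2 * 3 * l) * (L * sqrt (real d) * C * D * real T / sqrt (real m))"
          by simp
        \<comment> \<open>The bound reached is linear in l and D and free of sqrt p; l \<ge> 1, D >
          1 and p \<ge> 1 weaken it to the required form.\<close>
        also have "\<dots> \<le> (5 * l ^ 5) * X1"
        proof (rule mult_mono)
          have "sqrt 2 \<le> (5 / 3 :: real)" by (rule real_le_lsqrt) (simp_all add: power2_eq_square)
          then have "sqrt 2 * 3 \<le> (5::real)" by simp
          moreover have "l \<le> l ^ 5" using l self_le_power[of l 5] by simp
          ultimately show "sqrt 2 * 3 * l \<le> 5 * l ^ 5" using l by (intro mult_mono) auto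
          have "sqrt (real d) * 1 \<le> sqrt (real d) * sqrt (real p)"
            using p by (intro mult_left_mono) auto
          moreover have "D \<le> D\<^sup>2" using D by (simp add: power2_eq_square)
          ultimately show "L * sqrt (real d) * C * D * real T / sqrt (real m) \<le> X1"
            unfolding X1_def real_sqrt_mult using L C D
            by (intro divide_right_mono mult_mono) auto
        qed (use L C D l X in auto)
        finally show ?thesis .
      qed
      ultimately have "loss (S, G) \<le> Inf (val ` ?RF) + rest"
        using gX X by (simp add: rest_def algebra_simps)
      then show "(S, G) \<in> A" using SG by (simp add: A_Inf)
    qed
    with E(2) show ?thesis by linarith
  qed
  have rest: "val g + rest = (\<Sum>t=1..T. ell t (g (x t)))
        + 5 * (1 + ln (real d / \<delta>)) ^ nat \<lceil>5::real\<rceil> * L * sqrt (real d * real p) * C * D\<^sup>2 * real T / sqrt (real m)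
        + 5 * (C * L * D * sqrt (real d * real T) + C * L * D\<^sup>2 * real d * real T / sqrt (real m))" for g
  proof -
    have "5 * (1 + ln (real d / \<delta>)) ^ nat \<lceil>5::real\<rceil> * L * sqrt (real d * real p) * C * D\<^sup>2 * real T / sqrt (real m)
        = 5 * l ^ 5 * X1"
      unfolding X1_def l_def by (simp only: ceiling_numeral nat_numeral times_divide_eq_right mult.assoc)
    then show ?thesis unfolding val_def rest_def X2_def X3_def by (simp only: add.assoc)
  qed
  show "let b = sqrt (real m); R = D * sqrt (real d);
         \<eta> = (\<lambda>t::nat. 2 * R / (C * L) * (real t) powr (-1/2))
     in measure (init_measure p d m)
          {\<omega> \<in> space (init_measure p d m).
             \<forall>g\<in>RF_space_vec \<sigma> p d D.
               (\<Sum>t=1..T. ell t (net \<sigma> p d m b (init_signs m (fst \<omega>))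
                   (ogd \<sigma> p d m b (init_signs m (fst \<omega>)) (init_theta m (snd \<omega>)) R \<eta> ell x (t - 1)) (x t)))
               \<le> (\<Sum>t=1..T. ell t (g (x t)))
                 + 5 * (1 + ln (real d / \<delta>)) ^ nat \<lceil>5::real\<rceil> * L * sqrt (real d * real p) * C * D\<^sup>2 * real T / sqrt (real m)
                 + 5 * (C * L * D * sqrt (real d * real T) + C * L * D\<^sup>2 * real d * real T / sqrt (real m))}
        \<ge> 1 - \<delta>"
    using main unfolding Let_def A_def rest loss_def b_def R_def \<eta>_def .
qed

end
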